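(* Let $(M^3,\phi,\zeta,\eta,g)$ be a 3-dimensional para-Sasakian manifold. Suppose $M$ admits a proper $h$-almost gradient Ricci-Yamabe soliton, i.e. there are smooth functions $f,h,\lambda:M\to\mathbb{R}$ and constants $\alpha,\beta\in\mathbb{R}$ with $\alpha\neq0,1$ such that $$h\nabla^2 f+\Big(\lambda-\frac{\beta}{2}r\Big)g+\alpha S=0 .$$ Then $M$ is locally isometric to $\mathbb{H}^3(1)$, the model space of constant sectional curvature $-1$ (of the same signature as $g$).
   Context: All objects are smooth. $\nabla$ is the Levi-Civita connection of the semi-Riemannian metric $g$, $R(X,Y)Z=\nabla_X\nabla_YZ-\nabla_Y\nabla_XZ-\nabla_{[X,Y]}Z$, $S(Y,Z)=\mathrm{tr}(X\mapsto R(X,Y)Z)$ is the Ricci tensor, $r$ the scalar curvature. $Df$ is the gradient of $f$ and $\nabla^2f(X,Y)=g(\nabla_XDf,Y)$ its Hessian. Almost paracontact metric manifold $(M^{2n+1},\phi,\zeta,\eta,g)$ (here $n=1$): $\phi$ is a $(1,1)$-tensor field, $\zeta$ a vector field, $\eta$ a 1-form, with $\phi^2=I-\eta\otimes\zeta$, $\eta(\zeta)=1$, the $\pm1$-eigendistributions of $\phi$ on $\ker\eta$ both have dimension $n$, and $g$ is a semi-Riemannian metric with $g(\phi X,\phi Y)=-g(X,Y)+\eta(X)\eta(Y)$. It follows that $\phi\zeta=0$, $\eta\circ\phi=0$, $\eta=g(\cdot,\zeta)$, and $g$ has signature $(n+1,n)$. Paracontact metric manifold: in addition $d\eta(X,Y)=g(X,\phi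 Y)$, with the convention $2d\eta(X,Y)=X\eta(Y)-Y\eta(X)-\eta([X,Y])$. Normal: the tensor $[\phi,\phi]-2d\eta\otimes\zeta$ vanishes, where $[\phi,\phi]$ is the Nijenhuis torsion of $\phi$. Para-Sasakian manifold: a normal paracontact metric manifold. Such a manifold satisfies $(\nabla_X\phi)Y=-g(X,Y)\zeta+\eta(Y)X$, $\nabla_X\zeta=-\phi X$, $R(X,Y)\zeta=\eta(X)Y-\eta(Y)X$ and $S(X,\zeta)=-2n\,\eta(X)$. In dimension 3 it is known that $\zeta r=0$ and $S=(\frac r2+1)g-(\frac r2+3)\eta\otimes\eta$. Being locally isometric to $\mathbb{H}^3(1)$ is understood as having constant sectional curvature $-1$, i.e. $R(X,Y)Z=-[g(Y,Z)X-g(X,Z)Y]$ for all vector fields $X,Y,Z$. *)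

theory Defs
  imports "HOL-Analysis.Analysis" "HOL-Library.Function_Algebras"
begin

text \<open>Only meaningful for open \<^term>\<open>S\<close>. Closing under all directional derivatives is the
  same as asking for all iterated partial derivatives to exist and be continuous.\<close>

primrec Ck_on :: "nat \<Rightarrow> 'v::euclidean_space set \<Rightarrow> ('v \<Rightarrow> 'w::real_normed_vector) \<Rightarrow> bool" where
  "Ck_on 0 S f \<longleftrightarrow> continuous_on S f"
| "Ck_on (Suc k) S f \<longleftrightarrow>
     (\<forall>x\<in>S. f differentiable (at x)) \<and>
     (\<forall>v. Ck_on k S (\<lambda>x. frechet_derivative f (at x) v))"

definition smooth_on :: "'v::euclidean_space set \<Rightarrow> ('v \<Rightarrow> 'w::real_normed_vector) \<Rightarrow> bool" where
  "smooth_on S f \<longleftrightarrow> (\<forall>k. Ck_on k S f)"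

text \<open>The manifold is the whole type \<^typ>\<open>'a\<close>; the Hausdorff and second countability axioms are
  the sort constraint. A chart is a pair of its domain and its coordinate map (the values of the
  coordinate map off the domain are irrelevant).\<close>

type_synonym ('a, 'n) chart = "'a set \<times> ('a \<Rightarrow> real ^ 'n)"
type_synonym ('a, 'n) atlas = "('a, 'n) chart set"

definition smooth_atlas ::
  "('a::{t2_space, second_countable_topology}, 'n::finite) atlas \<Rightarrow> bool" where
  "smooth_atlas A \<longleftrightarrow>
     (\<Union>(U, c)\<in>A. U) = UNIV \<and>
     (\<forall>(U, c)\<in>A. open U \<and> open (c ` U) \<and> homeomorphism U (c ` U) c (inv_into U c)) \<and>
     (\<forall>(U, c)\<in>A. \<forall>(V, d)\<in>A. smooth_on (c ` (U \<inter> V)) (d \<circ> inv_into U c))"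

definition smooth_fun ::
  "('a::topological_space, 'n::finite) atlas \<Rightarrow> 'a set \<Rightarrow> ('a \<Rightarrow> real) \<Rightarrow> bool" where
  "smooth_fun A U f \<longleftrightarrow>
     open U \<and> (\<forall>(V, c)\<in>A. smooth_on (c ` (U \<inter> V)) (f \<circ> inv_into V c))"

definition smooth_near ::
  "('a::topological_space, 'n::finite) atlas \<Rightarrow> 'a \<Rightarrow> ('a \<Rightarrow> real) \<Rightarrow> bool" where
  "smooth_near A p f \<longleftrightarrow> (\<exists>U. p \<in> U \<and> smooth_fun A U f)"

text \<open>Functions into a real vector space form a real vector space pointwise; the additive
  structure is that of \<^theory>\<open>HOL-Library.Function_Algebras\<close>.\<close>

instantiation "fun" :: (type, real_vector) real_vector
begin

definition scaleR_fun :: "real \<Rightarrow> ('a \<Rightarrow> 'b) \<Rightarrow> 'a \<Rightarrow> 'b" where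
  "scaleR_fun a f = (\<lambda>x. a *\<^sub>R f x)"

instance
  by standard (auto simp: scaleR_fun_def fun_eq_iff plus_fun_def scaleR_add_right scaleR_add_left)

end

text \<open>A tangent vector at \<open>p\<close> is a directional derivative \<open>f \<mapsto> v f\<close> at \<open>p\<close>, acting on the
  functions that are smooth near \<open>p\<close>. It is set to \<open>0\<close> on all other functions, so that equality of
  tangent vectors is equality of the functionals.\<close>

type_synonym 'a tvec = "('a \<Rightarrow> real) \<Rightarrow> real"
type_synonym 'a vfield = "'a \<Rightarrow> 'a tvec"

definition coord_tvec ::
  "('a::topological_space, 'n::finite) atlas \<Rightarrow> ('a, 'n) chart \<Rightarrow> 'a \<Rightarrow> real ^ 'n \<Rightarrow> 'a tvec" where
  "coord_tvec A = (\<lambda>(V, c) p w f.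
     if smooth_near A p f then frechet_derivative (f \<circ> inv_into V c) (at (c p)) w else 0)"

definition tangent_space ::
  "('a::topological_space, 'n::finite) atlas \<Rightarrow> 'a \<Rightarrow> 'a tvec set" where
  "tangent_space A p = {coord_tvec A (V, c) p w | V c w. (V, c) \<in> A \<and> p \<in> V}"

definition app :: "'a vfield \<Rightarrow> ('a \<Rightarrow> real) \<Rightarrow> 'a \<Rightarrow> real" where
  "app X f = (\<lambda>p. X p f)"

text \<open>Smooth vector fields on an open set \<open>U\<close>. A field is a total function, of which only the
  restriction to \<open>U\<close> matters. Identities between fields are required below on every open set \<open>U\<close>
  (including the whole manifold); as they are local, this is the same as requiring them for
  global fields.\<close>

definition smooth_vfield ::
  "('a::topological_space, 'n::finite) atlas \<Rightarrow> 'a set \<Rightarrow> 'a vfield \<Rightarrow> bool" where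
  "smooth_vfield A U X \<longleftrightarrow>
     open U \<and> (\<forall>p\<in>U. X p \<in> tangent_space A p) \<and>
     (\<forall>V f. V \<subseteq> U \<longrightarrow> smooth_fun A V f \<longrightarrow> smooth_fun A V (app X f))"

definition fmult :: "('a \<Rightarrow> real) \<Rightarrow> 'a vfield \<Rightarrow> 'a vfield" where
  "fmult f X = (\<lambda>p. f p *\<^sub>R X p)"

definition bracket ::
  "('a::topological_space, 'n::finite) atlas \<Rightarrow> 'a vfield \<Rightarrow> 'a vfield \<Rightarrow> 'a vfield" where
  "bracket A X Y =
     (\<lambda>p f. if smooth_near A p f then X p (app Y f) - Y p (app X f) else 0)"

definition linear_map_on ::
  "'v::real_vector set \<Rightarrow> ('v \<Rightarrow> 'w::real_vector) \<Rightarrow> bool" where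
  "linear_map_on V F \<longleftrightarrow>
     (\<forall>x\<in>V. \<forall>y\<in>V. \<forall>a b. F (a *\<^sub>R x + b *\<^sub>R y) = a *\<^sub>R F x + b *\<^sub>R F y)"

type_synonym 'a endo_field = "'a \<Rightarrow> 'a tvec \<Rightarrow> 'a tvec"
type_synonym 'a form1 = "'a \<Rightarrow> 'a tvec \<Rightarrow> real"
type_synonym 'a form2 = "'a \<Rightarrow> 'a tvec \<Rightarrow> 'a tvec \<Rightarrow> real"

definition ap_endo :: "'a endo_field \<Rightarrow> 'a vfield \<Rightarrow> 'a vfield" where
  "ap_endo \<phi> X = (\<lambda>p. \<phi> p (X p))"

definition ap1 :: "'a form1 \<Rightarrow> 'a vfield \<Rightarrow> 'a \<Rightarrow> real" where
  "ap1 \<eta> X = (\<lambda>p. \<eta> p (X p))"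

definition ap2 :: "'a form2 \<Rightarrow> 'a vfield \<Rightarrow> 'a vfield \<Rightarrow> 'a \<Rightarrow> real" where
  "ap2 g X Y = (\<lambda>p. g p (X p) (Y p))"

definition smooth_endo_field ::
  "('a::topological_space, 'n::finite) atlas \<Rightarrow> 'a endo_field \<Rightarrow> bool" where
  "smooth_endo_field A \<phi> \<longleftrightarrow>
     (\<forall>p. \<phi> p ` tangent_space A p \<subseteq> tangent_space A p \<and>
          linear_map_on (tangent_space A p) (\<phi> p)) \<and>
     (\<forall>U X. smooth_vfield A U X \<longrightarrow> smooth_vfield A U (ap_endo \<phi> X))"

definition smooth_form1 ::
  "('a::topological_space, 'n::finite) atlas \<Rightarrow> 'a form1 \<Rightarrow> bool" where
  "smooth_form1 A \<eta> \<longleftrightarrow>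
     (\<forall>p. linear_map_on (tangent_space A p) (\<eta> p)) \<and>
     (\<forall>U X. smooth_vfield A U X \<longrightarrow> smooth_fun A U (ap1 \<eta> X))"

text \<open>Symmetric and nondegenerate, of any signature. Constancy of the index is automatic
  on connected components, and for paracontact structures the signature is forced.\<close>

definition semi_riemannian_metric ::
  "('a::topological_space, 'n::finite) atlas \<Rightarrow> 'a form2 \<Rightarrow> bool" where
  "semi_riemannian_metric A g \<longleftrightarrow>
     (\<forall>p. \<forall>v\<in>tangent_space A p. linear_map_on (tangent_space A p) (g p v)) \<and>
     (\<forall>p. \<forall>v\<in>tangent_space A p. \<forall>w\<in>tangent_space A p. g p v w = g p w v) \<and>
     (\<forall>p. \<forall>v\<in>tangent_space A p. (\<forall>w\<in>tangent_space A p. g p v w = 0) \<longrightarrow> v = 0) \<and>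
     (\<forall>U X Y. smooth_vfield A U X \<longrightarrow> smooth_vfield A U Y \<longrightarrow> smooth_fun A U (ap2 g X Y))"

type_synonym 'a connection = "'a vfield \<Rightarrow> 'a vfield \<Rightarrow> 'a vfield"

definition affine_connection ::
  "('a::topological_space, 'n::finite) atlas \<Rightarrow> 'a connection \<Rightarrow> bool" where
  "affine_connection A D \<longleftrightarrow>
     (\<forall>U X Y. smooth_vfield A U X \<longrightarrow> smooth_vfield A U Y \<longrightarrow> smooth_vfield A U (D X Y)) \<and>
     (\<forall>U X X' Y. smooth_vfield A U X \<longrightarrow> smooth_vfield A U X' \<longrightarrow> smooth_vfield A U Y \<longrightarrow>
        (\<forall>p\<in>U. D (X + X') Y p = D X Y p + D X' Y p)) \<and>
     (\<forall>U X Y Y'. smooth_vfield A U X \<longrightarrow> smooth_vfield A U Y \<longrightarrow> smooth_vfield A U Y' \<longrightarrow>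
        (\<forall>p\<in>U. D X (Y + Y') p = D X Y p + D X Y' p)) \<and>
     (\<forall>U f X Y. smooth_fun A U f \<longrightarrow> smooth_vfield A U X \<longrightarrow> smooth_vfield A U Y \<longrightarrow>
        (\<forall>p\<in>U. D (fmult f X) Y p = f p *\<^sub>R D X Y p \<and>
               D X (fmult f Y) p = app X f p *\<^sub>R Y p + f p *\<^sub>R D X Y p))"

text \<open>Torsion-free and metric. This determines \<open>D X Y\<close> on \<open>U\<close> whenever \<open>X\<close> and \<open>Y\<close> are smooth
  on \<open>U\<close>; the values of \<open>D\<close> on other fields play no role.\<close>

definition levi_civita ::
  "('a::topological_space, 'n::finite) atlas \<Rightarrow> 'a form2 \<Rightarrow> 'a connection \<Rightarrow> bool" where
  "levi_civita A g D \<longleftrightarrow>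
     affine_connection A D \<and>
     (\<forall>U X Y. smooth_vfield A U X \<longrightarrow> smooth_vfield A U Y \<longrightarrow>
        (\<forall>p\<in>U. D X Y p - D Y X p = bracket A X Y p)) \<and>
     (\<forall>U X Y Z. smooth_vfield A U X \<longrightarrow> smooth_vfield A U Y \<longrightarrow> smooth_vfield A U Z \<longrightarrow>
        (\<forall>p\<in>U. app X (ap2 g Y Z) p = ap2 g (D X Y) Z p + ap2 g Y (D X Z) p))"

definition curvature ::
  "('a::topological_space, 'n::finite) atlas \<Rightarrow> 'a connection \<Rightarrow>
    'a vfield \<Rightarrow> 'a vfield \<Rightarrow> 'a vfield \<Rightarrow> 'a vfield" where
  "curvature A D X Y Z = D X (D Y Z) - D Y (D X Z) - D (bracket A X Y) Z"

text \<open>The value of the curvature on tangent vectors at a point, computed with any smooth local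
  extensions.\<close>

definition curvature_at ::
  "('a::topological_space, 'n::finite) atlas \<Rightarrow> 'a connection \<Rightarrow> 'a \<Rightarrow>
    'a tvec \<Rightarrow> 'a tvec \<Rightarrow> 'a tvec \<Rightarrow> 'a tvec" where
  "curvature_at A D p x y z =
     (THE w. \<exists>U X Y Z. p \<in> U \<and>
        smooth_vfield A U X \<and> smooth_vfield A U Y \<and> smooth_vfield A U Z \<and>
        X p = x \<and> Y p = y \<and> Z p = z \<and> w = curvature A D X Y Z p)"

text \<open>Trace of an endomorphism \<open>F\<close> of a finite-dimensional subspace \<open>V\<close>, as the sum of the diagonal
  entries in some basis (the choice does not matter).\<close>

definition trace_on :: "'v::real_vector set \<Rightarrow> ('v \<Rightarrow> 'v) \<Rightarrow> real" where
  "trace_on V F =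
     (let B = (SOME B. independent B \<and> span B = V) in \<Sum>b\<in>B. representation B (F b) b)"

definition ricci ::
  "('a::topological_space, 'n::finite) atlas \<Rightarrow> 'a connection \<Rightarrow> 'a form2" where
  "ricci A D p y z = trace_on (tangent_space A p) (\<lambda>x. curvature_at A D p x y z)"

text \<open>The Ricci operator \<open>Q\<close>, with \<open>g(QY,Z) = S(Y,Z)\<close>; its trace is the scalar curvature.\<close>

definition ricci_op ::
  "('a::topological_space, 'n::finite) atlas \<Rightarrow> 'a form2 \<Rightarrow> 'a connection \<Rightarrow> 'a endo_field" where
  "ricci_op A g D p y =
     (THE w. w \<in> tangent_space A p \<and> (\<forall>z\<in>tangent_space A p. g p w z = ricci A D p y z))"

definition scalar_curvature ::
  "('a::topological_space, 'n::finite) atlas \<Rightarrow> 'a form2 \<Rightarrow> 'a connection \<Rightarrow> 'a \<Rightarrow> real" where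
  "scalar_curvature A g D p = trace_on (tangent_space A p) (ricci_op A g D p)"

text \<open>The condition that all nondegenerate tangent planes have sectional curvature \<open>k\<close>, in
  its tensorial form.\<close>

definition constant_curvature ::
  "('a::topological_space, 'n::finite) atlas \<Rightarrow> 'a form2 \<Rightarrow> 'a connection \<Rightarrow> real \<Rightarrow> bool" where
  "constant_curvature A g D k \<longleftrightarrow>
     (\<forall>U X Y Z. smooth_vfield A U X \<longrightarrow> smooth_vfield A U Y \<longrightarrow> smooth_vfield A U Z \<longrightarrow>
        (\<forall>p\<in>U. curvature A D X Y Z p = k *\<^sub>R (ap2 g Y Z p *\<^sub>R X p - ap2 g X Z p *\<^sub>R Y p)))"

definition gradient ::
  "('a::topological_space, 'n::finite) atlas \<Rightarrow> 'a form2 \<Rightarrow> ('a \<Rightarrow> real) \<Rightarrow> 'a vfield" where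
  "gradient A g f p =
     (THE v. v \<in> tangent_space A p \<and> (\<forall>w\<in>tangent_space A p. g p v w = w f))"

definition hessian ::
  "('a::topological_space, 'n::finite) atlas \<Rightarrow> 'a form2 \<Rightarrow> 'a connection \<Rightarrow> ('a \<Rightarrow> real) \<Rightarrow>
    'a vfield \<Rightarrow> 'a vfield \<Rightarrow> 'a \<Rightarrow> real" where
  "hessian A g D f X Y = ap2 g (D X (gradient A g f)) Y"

definition almost_paracontact_metric ::
  "nat \<Rightarrow> ('a::topological_space, 'n::finite) atlas \<Rightarrow>
    'a endo_field \<Rightarrow> 'a vfield \<Rightarrow> 'a form1 \<Rightarrow> 'a form2 \<Rightarrow> bool" where
  "almost_paracontact_metric n A \<phi> \<zeta> \<eta> g \<longleftrightarrow>
     CARD('n) = 2 * n + 1 \<and>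
     smooth_endo_field A \<phi> \<and> smooth_vfield A UNIV \<zeta> \<and> smooth_form1 A \<eta> \<and>
     semi_riemannian_metric A g \<and>
     (\<forall>p. \<forall>v\<in>tangent_space A p. \<phi> p (\<phi> p v) = v - \<eta> p v *\<^sub>R \<zeta> p) \<and>
     (\<forall>p. \<eta> p (\<zeta> p) = 1) \<and>
     (\<forall>p. dim {v \<in> tangent_space A p. \<eta> p v = 0 \<and> \<phi> p v = v} = n \<and>
          dim {v \<in> tangent_space A p. \<eta> p v = 0 \<and> \<phi> p v = - v} = n) \<and>
     (\<forall>p. \<forall>v\<in>tangent_space A p. \<forall>w\<in>tangent_space A p.
        g p (\<phi> p v) (\<phi> p w) = - g p v w + \<eta> p v * \<eta> p w)"

text \<open>Exterior derivative with the convention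
  \<open>2 d\<eta>(X,Y) = X \<eta>(Y) - Y \<eta>(X) - \<eta>([X,Y])\<close>.\<close>

definition ext_deriv ::
  "('a::topological_space, 'n::finite) atlas \<Rightarrow> 'a form1 \<Rightarrow> 'a vfield \<Rightarrow> 'a vfield \<Rightarrow> 'a \<Rightarrow> real" where
  "ext_deriv A \<eta> X Y p =
     (app X (ap1 \<eta> Y) p - app Y (ap1 \<eta> X) p - ap1 \<eta> (bracket A X Y) p) / 2"

definition paracontact_metric ::
  "nat \<Rightarrow> ('a::topological_space, 'n::finite) atlas \<Rightarrow>
    'a endo_field \<Rightarrow> 'a vfield \<Rightarrow> 'a form1 \<Rightarrow> 'a form2 \<Rightarrow> bool" where
  "paracontact_metric n A \<phi> \<zeta> \<eta> g \<longleftrightarrow>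
     almost_paracontact_metric n A \<phi> \<zeta> \<eta> g \<and>
     (\<forall>U X Y. smooth_vfield A U X \<longrightarrow> smooth_vfield A U Y \<longrightarrow>
        (\<forall>p\<in>U. ext_deriv A \<eta> X Y p = ap2 g X (ap_endo \<phi> Y) p))"

definition nijenhuis ::
  "('a::topological_space, 'n::finite) atlas \<Rightarrow> 'a endo_field \<Rightarrow>
    'a vfield \<Rightarrow> 'a vfield \<Rightarrow> 'a vfield" where
  "nijenhuis A \<phi> X Y =
     ap_endo \<phi> (ap_endo \<phi> (bracket A X Y)) + bracket A (ap_endo \<phi> X) (ap_endo \<phi> Y)
     - ap_endo \<phi> (bracket A (ap_endo \<phi> X) Y) - ap_endo \<phi> (bracket A X (ap_endo \<phi> Y))"

definition normal_structure ::
  "('a::topological_space, 'n::finite) atlas \<Rightarrow>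
    'a endo_field \<Rightarrow> 'a vfield \<Rightarrow> 'a form1 \<Rightarrow> bool" where
  "normal_structure A \<phi> \<zeta> \<eta> \<longleftrightarrow>
     (\<forall>U X Y. smooth_vfield A U X \<longrightarrow> smooth_vfield A U Y \<longrightarrow>
        (\<forall>p\<in>U. nijenhuis A \<phi> X Y p - (2 * ext_deriv A \<eta> X Y p) *\<^sub>R \<zeta> p = 0))"

definition para_sasakian ::
  "nat \<Rightarrow> ('a::topological_space, 'n::finite) atlas \<Rightarrow>
    'a endo_field \<Rightarrow> 'a vfield \<Rightarrow> 'a form1 \<Rightarrow> 'a form2 \<Rightarrow> bool" where
  "para_sasakian n A \<phi> \<zeta> \<eta> g \<longleftrightarrow>
     paracontact_metric n A \<phi> \<zeta> \<eta> g \<and> normal_structure A \<phi> \<zeta> \<eta>"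

definition h_almost_gradient_RY_soliton ::
  "('a::topological_space, 'n::finite) atlas \<Rightarrow> 'a form2 \<Rightarrow> 'a connection \<Rightarrow>
    ('a \<Rightarrow> real) \<Rightarrow> ('a \<Rightarrow> real) \<Rightarrow> ('a \<Rightarrow> real) \<Rightarrow> real \<Rightarrow> real \<Rightarrow> bool" where
  "h_almost_gradient_RY_soliton A g D h f lam \<alpha> \<beta> \<longleftrightarrow>
     smooth_fun A UNIV h \<and> smooth_fun A UNIV f \<and> smooth_fun A UNIV lam \<and>
     (\<forall>U X Y. smooth_vfield A U X \<longrightarrow> smooth_vfield A U Y \<longrightarrow>
        (\<forall>p\<in>U. h p * hessian A g D f X Y p
                + (lam p - \<beta> / 2 * scalar_curvature A g D p) * ap2 g X Y p
                + \<alpha> * ap2 (ricci A D) X Y p = 0))"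

definition proper_h_almost_gradient_RY_soliton ::
  "('a::topological_space, 'n::finite) atlas \<Rightarrow> 'a form2 \<Rightarrow> 'a connection \<Rightarrow>
    ('a \<Rightarrow> real) \<Rightarrow> ('a \<Rightarrow> real) \<Rightarrow> ('a \<Rightarrow> real) \<Rightarrow> real \<Rightarrow> real \<Rightarrow> bool" where
  "proper_h_almost_gradient_RY_soliton A g D h f lam \<alpha> \<beta> \<longleftrightarrow>
     h_almost_gradient_RY_soliton A g D h f lam \<alpha> \<beta> \<and> \<alpha> \<noteq> 0 \<and> \<alpha> \<noteq> 1"

end

(*
  Near every point there is a null frame (zeta, P, Q) with phi P = P, phi Q = - Q and g(P, Q) = 1.
  The contact condition, normality and the Jacobi identity give nabla_P zeta = - P and
  nabla_Q zeta = Q, hence R(X,Y)zeta = eta(X)Y - eta(Y)X, so that the whole curvature is determined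
  by the function kappa = g(R(P,Q)P, Q); constant curvature - 1 means kappa = - 1.
  Put G = Df. If h = 0 at p, the soliton equation makes S proportional to g at p, so kappa = - 1.
  If h is nonzero at p, the soliton equation gives nabla_P G = s P and nabla_Q G = s Q near p, and
  expanding 0 = - g(G, R(P,Q)zeta) = g(R(P,Q)G, zeta) gives s = (nabla^2 f)(zeta, zeta), which
  together with the soliton equation again forces kappa = - 1.
*)
theory Submission
  imports Defs
begin

section \<open>Functions of class \<open>C\<^sup>k\<close>\<close>

text \<open>The structure equations already fix the sectional curvature of every nondegenerate plane
  through \<open>\<zeta>\<close> at -1; only that of the plane ker \<open>\<eta>\<close> stays free,
  which is why a single function \<open>kappa\<close> is left to determine. Differentiating the
  soliton equation itself would bring in unknown derivatives of h, \<open>lam\<close>, the scalar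
  curvature and \<open>kappa\<close>. Two facts avoid this. The derivatives of the common factor s
  come multiplied by P or Q, which are orthogonal to \<open>\<zeta>\<close>; and the contact
  condition gives [P, Q] the \<open>\<zeta>\<close>-component 2, so the
  \<open>\<zeta>\<close>-component of R(P,Q)G is an algebraic relation in the undifferentiated s.
  Nothing is known about the zero set of h, so both cases are settled at the single point, without a
  limit argument. The formal obstacle is that a field is a total function of which only the values
  on an open set count. Two fields are typically equal on that set only, and the congruence rules
  for brackets, \<open>D\<close> and curvature make such equalities usable.\<close>

lemma frechet_derivative_cong_open:
  assumes "open S" "x \<in> S" "\<And>y. y \<in> S \<Longrightarrow> f y = g y"
  shows "frechet_derivative f (at x) = frechet_derivative g (at x)"
proof -
  have "(f has_derivative F) (at x) = (g has_derivative F) (at x)" for F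
    using assms by (metis has_derivative_transform_within_open)
  then show ?thesis unfolding frechet_derivative_def by simp
qed

lemma differentiable_cong_open:
  assumes "open S" "x \<in> S" "\<And>y. y \<in> S \<Longrightarrow> f y = g y" "f differentiable (at x)"
  shows "g differentiable (at x)"
  using assms unfolding differentiable_def by (metis has_derivative_transform_within_open)

text \<open>Derivatives at a point see a function only near that point, so openness of S carries the
  equality on to all higher derivatives.\<close>

lemma Ck_on_cong:
  assumes "open S" "\<And>x. x \<in> S \<Longrightarrow> f x = g x" "Ck_on k S f"
  shows "Ck_on k S g"
  using assms(2,3)
proof (induction k arbitrary: f g)
  case 0
  then show ?case by (simp cong: continuous_on_cong)
next
  case (Suc k)
  have "frechet_derivative f (at x) = frechet_derivative g (at x)" if "x \<in> S" for x
    using frechet_derivative_cong_open[OF assms(1) that] Suc.prems(1) by blast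
  moreover have "g differentiable (at x)" if "x \<in> S" for x
    using differentiable_cong_open[OF assms(1) that, of f g] Suc.prems that by simp
  ultimately show ?case
    using Suc.prems(2) Suc.IH[of "\<lambda>x. frechet_derivative f (at x) v" "\<lambda>x. frechet_derivative g (at x) v" for v]
    by simp
qed

lemma Ck_on_subset: "Ck_on k S f \<Longrightarrow> T \<subseteq> S \<Longrightarrow> Ck_on k T f"
  by (induction k arbitrary: f) (auto intro: continuous_on_subset)

lemma Ck_on_Suc_imp_continuous: "Ck_on (Suc k) S f \<Longrightarrow> continuous_on S f"
  by (auto intro!: continuous_at_imp_continuous_on differentiable_imp_continuous_within)

lemma Ck_on_SucD: "Ck_on (Suc k) S f \<Longrightarrow> Ck_on k S f"
proof (induction k arbitrary: f)
  case 0
  then show ?case using Ck_on_Suc_imp_continuous[of 0 S f] by simp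
next
  case (Suc k)
  then show ?case by (metis Ck_on.simps(2))
qed

lemma Ck_on_const: "Ck_on k S (\<lambda>_. a)"
proof (induction k arbitrary: a)
  case (Suc k)
  have "frechet_derivative (\<lambda>_. a) (at x) = (\<lambda>_. 0)" for x :: 'a
    using frechet_derivative_at[OF has_derivative_const[of a "at x"]] by simp
  then show ?case using Suc by simp
qed simp

lemma Ck_on_add:
  assumes "open S" "Ck_on k S f" "Ck_on k S g"
  shows "Ck_on k S (\<lambda>x. f x + g x)"
  using assms(2,3)
proof (induction k arbitrary: f g)
  case 0
  then show ?case by (simp add: continuous_on_add)
next
  case (Suc k)
  have eq: "frechet_derivative (\<lambda>x. f x + g x) (at x) v
      = frechet_derivative f (at x) v + frechet_derivative g (at x) v" if "x \<in> S" for x v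
  proof -
    have "((\<lambda>x. f x + g x) has_derivative
        (\<lambda>v. frechet_derivative f (at x) v + frechet_derivative g (at x) v)) (at x)"
      by (rule has_derivative_add) (use Suc.prems that in \<open>simp_all flip: frechet_derivative_works\<close>)
    from frechet_derivative_at[OF this] show ?thesis by (simp add: fun_eq_iff)
  qed
  have "Ck_on k S (\<lambda>x. frechet_derivative (\<lambda>x. f x + g x) (at x) v)" for v
  proof (rule Ck_on_cong[OF assms(1)])
    show "Ck_on k S (\<lambda>x. frechet_derivative f (at x) v + frechet_derivative g (at x) v)"
      using Suc.prems by (intro Suc.IH) simp_all
  qed (simp add: eq)
  moreover have "\<forall>x\<in>S. (\<lambda>x. f x + g x) differentiable (at x)"
    using Suc.prems by (simp add: differentiable_add)
  ultimately show ?case by simp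
qed

lemma Ck_on_sum:
  assumes "open S" "finite I" "\<And>i. i \<in> I \<Longrightarrow> Ck_on k S (f i)"
  shows "Ck_on k S (\<lambda>x. \<Sum>i\<in>I. f i x)"
  using assms(2,3) by (induction I) (auto intro!: Ck_on_const Ck_on_add assms(1))

text \<open>The product rule pairs a derivative of one factor with the other factor itself;
  \<open>Ck_on_SucD\<close> lowers the order of the latter so that the induction hypothesis applies
  to both products.\<close>

lemma Ck_on_mult:
  fixes f g :: "'v::euclidean_space \<Rightarrow> real"
  assumes "open S" "Ck_on k S f" "Ck_on k S g"
  shows "Ck_on k S (\<lambda>x. f x * g x)"
  using assms(2,3)
proof (induction k arbitrary: f g)
  case 0
  then show ?case by (auto intro: continuous_on_mult)
next
  case (Suc k)
  have eq: "frechet_derivative (\<lambda>x. f x * g x) (at x) v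
      = f x * frechet_derivative g (at x) v + frechet_derivative f (at x) v * g x" if "x \<in> S" for x v
  proof -
    have "((\<lambda>x. f x * g x) has_derivative
        (\<lambda>v. f x * frechet_derivative g (at x) v + frechet_derivative f (at x) v * g x)) (at x)"
      by (rule has_derivative_mult) (use Suc.prems that in \<open>simp_all flip: frechet_derivative_works\<close>)
    from frechet_derivative_at[OF this] show ?thesis by (simp add: fun_eq_iff)
  qed
  have "Ck_on k S (\<lambda>x. frechet_derivative (\<lambda>x. f x * g x) (at x) v)" for v
  proof (rule Ck_on_cong[OF assms(1)])
    show "Ck_on k S (\<lambda>x. f x * frechet_derivative g (at x) v + frechet_derivative f (at x) v * g x)"
      using Suc.prems Ck_on_SucD[OF Suc.prems(1)] Ck_on_SucD[OF Suc.prems(2)]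
      by (intro Ck_on_add assms(1) Suc.IH) simp_all
  qed (simp add: eq)
  moreover have "\<forall>x\<in>S. (\<lambda>x. f x * g x) differentiable (at x)"
    using Suc.prems by (simp add: differentiable_mult)
  ultimately show ?case by simp
qed

text \<open>The derivative of 1/f contains 1/f again, and the induction hypothesis for the same f
  supplies that factor. The sign is written as a constant factor so that closure under products
  suffices.\<close>

lemma Ck_on_inverse:
  fixes f :: "'v::euclidean_space \<Rightarrow> real"
  assumes "open S" "Ck_on k S f" "\<And>x. x \<in> S \<Longrightarrow> f x \<noteq> 0"
  shows "Ck_on k S (\<lambda>x. inverse (f x))"
  using assms(2)
proof (induction k)
  case 0
  then show ?case using assms(3) by (auto intro: continuous_on_inverse)
next
  case (Suc k)
  have eq: "frechet_derivative (\<lambda>x. inverse (f x)) (at x) v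
      = (-1) * (inverse (f x) * frechet_derivative f (at x) v * inverse (f x))" if "x \<in> S" for x v
  proof -
    have "((\<lambda>x. inverse (f x)) has_derivative
        (\<lambda>v. - (inverse (f x) * frechet_derivative f (at x) v * inverse (f x)))) (at x)"
      by (rule Deriv.has_derivative_inverse)
        (use Suc.prems that assms(3) in \<open>simp_all flip: frechet_derivative_works\<close>)
    from frechet_derivative_at[OF this] show ?thesis by (simp add: fun_eq_iff)
  qed
  have *: "Ck_on k S (\<lambda>x. inverse (f x))"
    using Suc.IH Ck_on_SucD[OF Suc.prems] by blast
  have "Ck_on k S (\<lambda>x. frechet_derivative (\<lambda>x. inverse (f x)) (at x) v)" for v
  proof (rule Ck_on_cong[OF assms(1)])
    show "Ck_on k S (\<lambda>x. (-1) * (inverse (f x) * frechet_derivative f (at x) v * inverse (f x)))"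
      using Suc.prems by (intro Ck_on_mult assms(1) Ck_on_const *) auto
  qed (use eq in auto)
  then show ?case using Suc.prems assms(3) by (auto intro: differentiable_inverse)
qed

lemma Ck_on_inner_const:
  fixes f :: "'v::euclidean_space \<Rightarrow> 'w::euclidean_space"
  assumes "open S" "Ck_on k S f"
  shows "Ck_on k S (\<lambda>x. f x \<bullet> b)"
  using assms(2)
proof (induction k arbitrary: f)
  case 0
  then show ?case by (simp add: continuous_on_inner)
next
  case (Suc k)
  have D: "((\<lambda>x. f x \<bullet> b) has_derivative (\<lambda>v. frechet_derivative f (at x) v \<bullet> b)) (at x)"
    if "x \<in> S" for x
    using Suc.prems that by (auto intro!: has_derivative_inner_left simp flip: frechet_derivative_works)
  have "Ck_on k S (\<lambda>x. frechet_derivative (\<lambda>x. f x \<bullet> b) (at x) v)" for v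
    by (rule Ck_on_cong[OF assms(1) _ Suc.IH[of "\<lambda>x. frechet_derivative f (at x) v"]])
       (use Suc.prems frechet_derivative_at[OF D] in \<open>auto dest: fun_cong\<close>)
  then show ?case using D by (auto simp: differentiable_def)
qed

text \<open>By the chain rule the derivative of g is applied to a direction that moves with x.
  Expanding this direction in \<open>Basis\<close> leaves derivatives of g in fixed directions
  composed with f, to which the induction hypothesis applies because g is arbitrary in it.\<close>

lemma Ck_on_compose:
  fixes f :: "'v::euclidean_space \<Rightarrow> 'w::euclidean_space" and g :: "'w \<Rightarrow> real"
  assumes "open S" "open T" "f ` S \<subseteq> T" "Ck_on k S f" "Ck_on k T g"
  shows "Ck_on k S (g \<circ> f)"
  using assms(4,5)
proof (induction k arbitrary: g)
  case 0
  then show ?case using assms(3) by (auto simp: o_def intro: continuous_on_compose2)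
next
  case (Suc k)
  have fd: "(f has_derivative frechet_derivative f (at x)) (at x)" if "x \<in> S" for x
    using Suc.prems that by (auto simp flip: frechet_derivative_works)
  have gd: "(g has_derivative frechet_derivative g (at (f x))) (at (f x))" if "x \<in> S" for x
    using Suc.prems that assms(3) by (auto simp flip: frechet_derivative_works)
  have D: "((g \<circ> f) has_derivative (frechet_derivative g (at (f x)) \<circ> frechet_derivative f (at x))) (at x)"
    if "x \<in> S" for x
    using diff_chain_at[OF fd gd] that by blast
  have eq: "frechet_derivative (g \<circ> f) (at x) v
     = (\<Sum>b\<in>Basis. (frechet_derivative f (at x) v \<bullet> b) * ((\<lambda>y. frechet_derivative g (at y) b) \<circ> f) x)"
    if x: "x \<in> S" for x v
  proof -
    let ?L = "frechet_derivative g (at (f x))" and ?w = "frechet_derivative f (at x) v"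
    interpret linear ?L using gd[OF x] has_derivative_linear by blast
    have "frechet_derivative (g \<circ> f) (at x) v = ?L ?w"
      using frechet_derivative_at[OF D[OF x]] by (simp add: fun_eq_iff)
    also have "\<dots> = ?L (\<Sum>b\<in>Basis. (?w \<bullet> b) *\<^sub>R b)" by (simp add: euclidean_representation)
    also have "\<dots> = (\<Sum>b\<in>Basis. (?w \<bullet> b) * ?L b)" by (simp add: sum scale)
    finally show ?thesis by simp
  qed
  have "Ck_on k S (\<lambda>x. frechet_derivative (g \<circ> f) (at x) v)" for v
  proof (rule Ck_on_cong[OF assms(1)])
    show "Ck_on k S (\<lambda>x. \<Sum>b\<in>Basis. (frechet_derivative f (at x) v \<bullet> b) * ((\<lambda>y. frechet_derivative g (at y) b) \<circ> f) x)"
      using Suc.prems Ck_on_SucD[OF Suc.prems(1)]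
      by (intro Ck_on_sum Ck_on_mult Ck_on_inner_const assms(1) Suc.IH) auto
  qed (use eq in auto)
  then show ?case using D unfolding Ck_on.simps differentiable_def by blast
qed

section \<open>Closure properties of smooth functions on Euclidean open sets\<close>

lemma smooth_on_cong:
  "open S \<Longrightarrow> (\<And>x. x \<in> S \<Longrightarrow> f x = g x) \<Longrightarrow> smooth_on S f \<Longrightarrow> smooth_on S g"
  unfolding smooth_on_def using Ck_on_cong by blast

lemma smooth_on_subset: "smooth_on S f \<Longrightarrow> T \<subseteq> S \<Longrightarrow> smooth_on T f"
  unfolding smooth_on_def using Ck_on_subset by blast

lemma smooth_on_const: "smooth_on S (\<lambda>_. a)"
  unfolding smooth_on_def using Ck_on_const by blast

lemma smooth_on_add:
  "open S \<Longrightarrow> smooth_on S f \<Longrightarrow> smooth_on S g \<Longrightarrow> smooth_on S (\<lambda>x. f x + g x)"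
  unfolding smooth_on_def using Ck_on_add by blast

lemma smooth_on_mult:
  fixes f g :: "'v::euclidean_space \<Rightarrow> real"
  shows "open S \<Longrightarrow> smooth_on S f \<Longrightarrow> smooth_on S g \<Longrightarrow> smooth_on S (\<lambda>x. f x * g x)"
  unfolding smooth_on_def using Ck_on_mult by blast

lemma smooth_on_inverse:
  fixes f :: "'v::euclidean_space \<Rightarrow> real"
  shows "open S \<Longrightarrow> smooth_on S f \<Longrightarrow> (\<And>x. x \<in> S \<Longrightarrow> f x \<noteq> 0) \<Longrightarrow> smooth_on S (\<lambda>x. inverse (f x))"
  unfolding smooth_on_def using Ck_on_inverse by blast

lemma smooth_on_compose:
  fixes f :: "'v::euclidean_space \<Rightarrow> 'w::euclidean_space" and g :: "'w \<Rightarrow> real"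
  shows "open S \<Longrightarrow> open T \<Longrightarrow> f ` S \<subseteq> T \<Longrightarrow> smooth_on S f \<Longrightarrow> smooth_on T g \<Longrightarrow> smooth_on S (g \<circ> f)"
  unfolding smooth_on_def using Ck_on_compose by blast

lemma smooth_on_frechet_derivative:
  "smooth_on S f \<Longrightarrow> smooth_on S (\<lambda>x. frechet_derivative f (at x) v)"
  unfolding smooth_on_def by (metis Ck_on.simps(2))

lemma smooth_on_has_derivative:
  "smooth_on S f \<Longrightarrow> x \<in> S \<Longrightarrow> (f has_derivative frechet_derivative f (at x)) (at x)"
  unfolding smooth_on_def by (metis Ck_on.simps(2) frechet_derivative_works)

lemma smooth_on_continuous_on: "smooth_on S f \<Longrightarrow> continuous_on S f"
  unfolding smooth_on_def by (metis Ck_on.simps(1))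

section \<open>Traces and one-dimensional subspaces\<close>

lemma linear_map_on_sum:
  assumes "subspace V" "linear_map_on V F" "finite B" "B \<subseteq> V"
  shows "F (\<Sum>b\<in>B. c b *\<^sub>R b) = (\<Sum>b\<in>B. c b *\<^sub>R F b)"
  using assms(3,4)
proof (induction B)
  case empty
  have "F (0 *\<^sub>R 0 + 0 *\<^sub>R 0) = 0 *\<^sub>R F 0 + 0 *\<^sub>R F 0"
    using assms(2) subspace_0[OF assms(1)] unfolding linear_map_on_def by blast
  then show ?case by simp
next
  case (insert b B)
  have "(\<Sum>b\<in>B. c b *\<^sub>R b) \<in> V"
    using insert.prems by (intro subspace_sum[OF assms(1)] subspace_scale[OF assms(1)]) blast
  then have "F (c b *\<^sub>R b + 1 *\<^sub>R (\<Sum>b\<in>B. c b *\<^sub>R b)) = c b *\<^sub>R F b + 1 *\<^sub>R F (\<Sum>b\<in>B. c b *\<^sub>R b)"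
    using assms(2) insert.prems unfolding linear_map_on_def by blast
  then show ?case using insert by simp
qed

text \<open>A rank one map x |-> a(x) e has trace a(e) in every basis. Writing an endomorphism as a
  sum of such maps therefore evaluates \<open>trace_on\<close> without knowing which basis
  \<open>SOME\<close> picks; the spanning set S makes that basis finite.\<close>

lemma trace_on_rank_one_sum:
  fixes V :: "'v::real_vector set"
  assumes V: "subspace V" and S: "finite S" "V \<subseteq> span S"
    and F: "\<And>x. x \<in> V \<Longrightarrow> F x = (\<Sum>(a, e)\<leftarrow>ps. a x *\<^sub>R e)"
    and ps: "\<And>a e. (a, e) \<in> set ps \<Longrightarrow> e \<in> V \<and> linear_map_on V a"
  shows "trace_on V F = (\<Sum>(a, e)\<leftarrow>ps. a e)"
proof -
  have "\<exists>B. independent B \<and> span B = V"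
    using maximal_independent_subset[of V] span_minimal[OF _ V] by (metis subset_antisym)
  then obtain B where Bdef: "B = (SOME B. independent B \<and> span B = V)"
    and B: "independent B" "span B = V" by (metis (mono_tags, lifting) someI_ex)
  have BV: "B \<subseteq> V" using B span_superset by blast
  have fin: "finite B" using independent_span_bound[OF S(1) B(1)] BV S(2) by blast
  have "(\<Sum>b\<in>B. representation B (\<Sum>(a, e)\<leftarrow>ps. a b *\<^sub>R e) b) = (\<Sum>(a, e)\<leftarrow>ps. a e)"
    using ps
  proof (induction ps)
    case Nil
    then show ?case by (simp add: representation_zero)
  next
    case (Cons ae ps)
    obtain a e where ae: "ae = (a, e)" by fastforce
    have e: "e \<in> V" "linear_map_on V a" using Cons.prems[of a e] ae by auto
    have ps: "e' \<in> V \<and> linear_map_on V a'" if "(a', e') \<in> set ps" for a' e'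
      using Cons.prems[of a' e'] that by simp
    have mem: "(\<Sum>(a, e)\<leftarrow>ps. a b *\<^sub>R e) \<in> span B" for b
      using ps unfolding B(2)
      by (induction ps) (auto intro!: subspace_0[OF V] subspace_add[OF V] subspace_scale[OF V])
    have "representation B (\<Sum>(a, e)\<leftarrow>ae # ps. a b *\<^sub>R e) b
        = a b * representation B e b + representation B (\<Sum>(a, e)\<leftarrow>ps. a b *\<^sub>R e) b" for b
    proof -
      have eB: "e \<in> span B" using e(1) B(2) by simp
      show ?thesis
        by (simp add: ae representation_add[OF B(1) mem span_scale[OF eB]] representation_scale[OF B(1) eB])
    qed
    then have "(\<Sum>b\<in>B. representation B (\<Sum>(a, e)\<leftarrow>ae # ps. a b *\<^sub>R e) b)
        = (\<Sum>b\<in>B. representation B e b *\<^sub>R a b) + (\<Sum>(a, e)\<leftarrow>ps. a e)"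
      using Cons.IH[OF ps] by (simp add: sum.distrib mult.commute)
    \<comment> \<open>Linearity moves a outside the sum, where it meets the expansion of e in the
      basis.\<close>
    also have "(\<Sum>b\<in>B. representation B e b *\<^sub>R a b) = a (\<Sum>b\<in>B. representation B e b *\<^sub>R b)"
      using linear_map_on_sum[OF V e(2) fin BV] by simp
    also have "(\<Sum>b\<in>B. representation B e b *\<^sub>R b) = e"
      using sum_representation_eq[OF B(1) _ fin] e(1) B(2) by simp
    finally show ?case by (simp add: ae)
  qed
  moreover have "trace_on V F = (\<Sum>b\<in>B. representation B (F b) b)"
    by (simp add: trace_on_def Let_def Bdef)
  moreover have "(\<Sum>b\<in>B. representation B (F b) b)
      = (\<Sum>b\<in>B. representation B (\<Sum>(a, e)\<leftarrow>ps. a b *\<^sub>R e) b)"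
    using BV F by (intro sum.cong) auto
  ultimately show ?thesis by simp
qed

text \<open>The value 1 excludes both the fallback 0 in the definition of \<open>dim\<close> and the
  cardinality 0 of an infinite basis, so the chosen basis is a singleton.\<close>

lemma dim_oneE:
  fixes S :: "'v::real_vector set"
  assumes "dim S = 1" obtains e where "e \<noteq> 0" "span S = span {e}"
proof -
  have ex: "\<exists>b. independent b \<and> span b = span S"
    using assms unfolding dim_def by (metis zero_neq_one)
  define b where "b = (SOME b. independent b \<and> span b = span S)"
  have b: "independent b" "span b = span S" using someI_ex[OF ex] unfolding b_def by blast+
  have "card b = 1" using assms ex unfolding dim_def b_def by simp
  then obtain e where e: "b = {e}" using card_1_singletonE by blast
  then have "e \<noteq> 0" using b(1) dependent_zero by blast
  then show ?thesis using that e b(2) by blast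
qed

lemma dim_one_scaleR:
  fixes S :: "'v::real_vector set"
  assumes "dim S = 1" "u \<in> S" "x \<in> S" "u \<noteq> 0"
  obtains t where "x = t *\<^sub>R u"
proof -
  obtain e where e: "span S = span {e}" using dim_oneE[OF assms(1)] by blast
  have "u \<in> span {e}" "x \<in> span {e}" using e assms(2,3) span_base by blast+
  then obtain k l where kl: "u = k *\<^sub>R e" "x = l *\<^sub>R e"
    unfolding span_singleton by blast
  have "k \<noteq> 0" using kl assms(4) by auto
  then have "x = (l / k) *\<^sub>R u" using kl by simp
  then show ?thesis using that by blast
qed

lemma dim_one_nonzero:
  fixes S :: "'v::real_vector set"
  assumes "dim S = 1" obtains u where "u \<in> S" "u \<noteq> 0"
proof -
  obtain e where e: "e \<noteq> 0" "span S = span {e}" using dim_oneE[OF assms] by blast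
  have False if "S \<subseteq> {0}"
    using span_mono[OF that] e span_base[of e "{e}"] by auto
  then show ?thesis using that by blast
qed

section \<open>Tangent vectors and vector fields\<close>

locale smooth_manifold =
  fixes A :: "('a::{t2_space, second_countable_topology}, 'n::finite) atlas"
  assumes atlas: "smooth_atlas A"
begin

lemma chart_at: obtains V c where "(V, c) \<in> A" "p \<in> V"
proof -
  have "p \<in> (\<Union>(U, c)\<in>A. U)" using atlas unfolding smooth_atlas_def by simp
  then show ?thesis using that by auto
qed

lemma chart_homeomorphism:
  "(V, c) \<in> A \<Longrightarrow> open V \<and> open (c ` V) \<and> homeomorphism V (c ` V) c (inv_into V c)"
  using atlas unfolding smooth_atlas_def by blast

lemma chart_open: "(V, c) \<in> A \<Longrightarrow> open V"
  using chart_homeomorphism by blast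

lemma chart_inv [simp]: "(V, c) \<in> A \<Longrightarrow> q \<in> V \<Longrightarrow> inv_into V c (c q) = q"
  using chart_homeomorphism[of V c] by (auto simp: homeomorphism_def)

lemma chart_image_open:
  assumes "(V, c) \<in> A" "open U" shows "open (c ` (U \<inter> V))"
proof -
  have "openin (top_of_set V) (U \<inter> V)" using assms(2) by (metis Int_commute openin_open_Int)
  then have "openin (top_of_set (c ` V)) (c ` (U \<inter> V))"
    using chart_homeomorphism[OF assms(1)] homeomorphism_imp_open_map by blast
  then show ?thesis using chart_homeomorphism[OF assms(1)] openin_open_trans by blast
qed

lemma transition_smooth:
  "(V, c) \<in> A \<Longrightarrow> (W, d) \<in> A \<Longrightarrow> smooth_on (c ` (V \<inter> W)) (d \<circ> inv_into V c)"
  using atlas unfolding smooth_atlas_def by blast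

section \<open>Smooth functions on the manifold\<close>

lemma smooth_fun_chart:
  "smooth_fun A U f \<Longrightarrow> (V, c) \<in> A \<Longrightarrow> smooth_on (c ` (U \<inter> V)) (f \<circ> inv_into V c)"
  unfolding smooth_fun_def by blast

lemma smooth_fun_open: "smooth_fun A U f \<Longrightarrow> open U"
  unfolding smooth_fun_def by blast

lemma smooth_funI:
  "open U \<Longrightarrow> (\<And>V c. (V, c) \<in> A \<Longrightarrow> smooth_on (c ` (U \<inter> V)) (f \<circ> inv_into V c)) \<Longrightarrow> smooth_fun A U f"
  unfolding smooth_fun_def by blast

lemma smooth_fun_cong:
  assumes "smooth_fun A U f" "\<And>q. q \<in> U \<Longrightarrow> f q = f' q"
  shows "smooth_fun A U f'"
proof (rule smooth_funI)
  fix V c assume V: "(V, c) \<in> A"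
  show "smooth_on (c ` (U \<inter> V)) (f' \<circ> inv_into V c)"
    by (rule smooth_on_cong[OF chart_image_open[OF V] _ smooth_fun_chart[OF assms(1) V]])
       (use assms smooth_fun_open V in auto)
qed (use assms(1) smooth_fun_open in blast)

lemma smooth_fun_subset:
  assumes "smooth_fun A U f" "W \<subseteq> U" "open W" shows "smooth_fun A W f"
proof (rule smooth_funI[OF assms(3)])
  fix V c assume V: "(V, c) \<in> A"
  show "smooth_on (c ` (W \<inter> V)) (f \<circ> inv_into V c)"
    by (rule smooth_on_subset[OF smooth_fun_chart[OF assms(1) V]]) (use assms(2) in blast)
qed

lemma smooth_fun_const: "open U \<Longrightarrow> smooth_fun A U (\<lambda>_. a)"
  by (rule smooth_funI) (simp_all add: o_def smooth_on_const)

lemma smooth_fun_add: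
  assumes "smooth_fun A U f" "smooth_fun A U g" shows "smooth_fun A U (\<lambda>q. f q + g q)"
proof (rule smooth_funI)
  fix V c assume V: "(V, c) \<in> A"
  have "open (c ` (U \<inter> V))" using chart_image_open V assms(1) smooth_fun_open by blast
  from smooth_on_add[OF this smooth_fun_chart[OF assms(1) V] smooth_fun_chart[OF assms(2) V]]
  show "smooth_on (c ` (U \<inter> V)) ((\<lambda>q. f q + g q) \<circ> inv_into V c)" by (simp add: o_def)
qed (use assms(1) smooth_fun_open in blast)

lemma smooth_fun_mult:
  assumes "smooth_fun A U f" "smooth_fun A U g" shows "smooth_fun A U (\<lambda>q. f q * g q)"
proof (rule smooth_funI)
  fix V c assume V: "(V, c) \<in> A"
  have "open (c ` (U \<inter> V))" using chart_image_open V assms(1) smooth_fun_open by blast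
  from smooth_on_mult[OF this smooth_fun_chart[OF assms(1) V] smooth_fun_chart[OF assms(2) V]]
  show "smooth_on (c ` (U \<inter> V)) ((\<lambda>q. f q * g q) \<circ> inv_into V c)" by (simp add: o_def)
qed (use assms(1) smooth_fun_open in blast)

lemma smooth_fun_inverse:
  assumes "smooth_fun A U f" "\<And>q. q \<in> U \<Longrightarrow> f q \<noteq> 0"
  shows "smooth_fun A U (\<lambda>q. inverse (f q))"
proof (rule smooth_funI)
  fix V c assume V: "(V, c) \<in> A"
  have "open (c ` (U \<inter> V))" using chart_image_open V assms(1) smooth_fun_open by blast
  moreover have "(f \<circ> inv_into V c) x \<noteq> 0" if "x \<in> c ` (U \<inter> V)" for x
    using that V assms(2) by auto
  ultimately have "smooth_on (c ` (U \<inter> V)) (\<lambda>x. inverse ((f \<circ> inv_into V c) x))"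
    using smooth_on_inverse[OF _ smooth_fun_chart[OF assms(1) V]] by blast
  then show "smooth_on (c ` (U \<inter> V)) ((\<lambda>q. inverse (f q)) \<circ> inv_into V c)" by (simp add: o_def)
qed (use assms(1) smooth_fun_open in blast)

lemma smooth_fun_continuous_on:
  assumes "smooth_fun A U f" shows "continuous_on U f"
proof -
  have U: "open U" using assms smooth_fun_open by blast
  have "isCont f p" if p: "p \<in> U" for p
  proof -
    obtain V c where V: "(V, c) \<in> A" "p \<in> V" using chart_at by blast
    have "continuous_on (c ` (U \<inter> V)) (f \<circ> inv_into V c)"
      using smooth_fun_chart[OF assms V(1)] smooth_on_continuous_on by blast
    moreover have "continuous_on (U \<inter> V) c"
      using chart_homeomorphism[OF V(1)] by (auto simp: homeomorphism_def intro: continuous_on_subset)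
    ultimately have "continuous_on (U \<inter> V) ((f \<circ> inv_into V c) \<circ> c)"
      using continuous_on_compose by blast
    then have "continuous_on (U \<inter> V) f"
      by (rule continuous_on_eq) (use V in auto)
    moreover have "open (U \<inter> V)" using U chart_open[OF V(1)] by blast
    ultimately show ?thesis using p V(2) continuous_on_eq_continuous_at by blast
  qed
  then show ?thesis using continuous_at_imp_continuous_on by blast
qed

text \<open>Supplies the neighbourhoods on which division by a function is possible: by g(P, Q) when
  the frame is normalised, and by h in the soliton equation.\<close>

lemma open_nonzero_set:
  assumes "smooth_fun A U f" shows "open {q \<in> U. f q \<noteq> 0}"
proof -
  have "open (U \<inter> f -` (- {0}))"
    by (rule continuous_open_preimage[OF smooth_fun_continuous_on[OF assms] smooth_fun_open[OF assms]])
       (simp add: open_Compl)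
  moreover have "U \<inter> f -` (- {0}) = {q \<in> U. f q \<noteq> 0}" by auto
  ultimately show ?thesis by simp
qed

section \<open>Tangent vectors as local derivations\<close>

lemma smooth_nearI: "p \<in> U \<Longrightarrow> smooth_fun A U f \<Longrightarrow> smooth_near A p f"
  unfolding smooth_near_def by blast

lemma coord_tvec_apply:
  "coord_tvec A (V, c) p w f =
     (if smooth_near A p f then frechet_derivative (f \<circ> inv_into V c) (at (c p)) w else 0)"
  by (simp add: coord_tvec_def)

lemma tangent_vectorE:
  assumes "v \<in> tangent_space A p"
  obtains V c w where "(V, c) \<in> A" "p \<in> V" "v = coord_tvec A (V, c) p w"
  using assms unfolding tangent_space_def by blast

lemma chart_has_derivative:
  assumes "smooth_fun A U f" "p \<in> U" "(V, c) \<in> A" "p \<in> V"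
  shows "((f \<circ> inv_into V c) has_derivative frechet_derivative (f \<circ> inv_into V c) (at (c p))) (at (c p))"
  using smooth_on_has_derivative[OF smooth_fun_chart[OF assms(1,3)]] assms by blast

lemma tvec_not_smooth: "v \<in> tangent_space A p \<Longrightarrow> \<not> smooth_near A p f \<Longrightarrow> v f = 0"
  by (erule tangent_vectorE) (simp add: coord_tvec_apply)

lemma tvec_cong:
  assumes "v \<in> tangent_space A p" "smooth_fun A U f" "p \<in> U" "\<And>q. q \<in> U \<Longrightarrow> f q = f' q"
  shows "v f = v f'"
proof -
  from assms(1) obtain V c w where V: "(V, c) \<in> A" "p \<in> V" "v = coord_tvec A (V, c) p w"
    by (rule tangent_vectorE)
  have "smooth_near A p f" "smooth_near A p f'"
    using assms smooth_fun_cong[OF assms(2,4)] smooth_nearI by blast+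
  moreover have "frechet_derivative (f \<circ> inv_into V c) (at (c p)) = frechet_derivative (f' \<circ> inv_into V c) (at (c p))"
    by (rule frechet_derivative_cong_open[of "c ` (U \<inter> V)"])
       (use V assms chart_image_open smooth_fun_open in auto)
  ultimately show ?thesis by (simp add: V(3) coord_tvec_apply)
qed

lemma tvec_const: "v \<in> tangent_space A p \<Longrightarrow> v (\<lambda>_. a) = 0"
  using frechet_derivative_at[OF has_derivative_const[of a "at x" for x]]
  by (erule_tac tangent_vectorE) (simp add: coord_tvec_apply o_def)

lemma tvec_add:
  assumes "v \<in> tangent_space A p" "smooth_fun A U f" "smooth_fun A U g" "p \<in> U"
  shows "v (\<lambda>q. f q + g q) = v f + v g"
proof -
  from assms(1) obtain V c w where V: "(V, c) \<in> A" "p \<in> V" "v = coord_tvec A (V, c) p w"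
    by (rule tangent_vectorE)
  have "smooth_near A p f" "smooth_near A p g" "smooth_near A p (\<lambda>q. f q + g q)"
    using assms smooth_fun_add smooth_nearI by blast+
  moreover note frechet_derivative_at[OF has_derivative_add[OF
      chart_has_derivative[OF assms(2,4) V(1,2)] chart_has_derivative[OF assms(3,4) V(1,2)]]]
  ultimately show ?thesis by (simp add: V(3) coord_tvec_apply o_def fun_eq_iff)
qed

lemma tvec_mult:
  assumes "v \<in> tangent_space A p" "smooth_fun A U f" "smooth_fun A U g" "p \<in> U"
  shows "v (\<lambda>q. f q * g q) = f p * v g + v f * g p"
proof -
  from assms(1) obtain V c w where V: "(V, c) \<in> A" "p \<in> V" "v = coord_tvec A (V, c) p w"
    by (rule tangent_vectorE)
  have "smooth_near A p f" "smooth_near A p g" "smooth_near A p (\<lambda>q. f q * g q)"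
    using assms smooth_fun_mult smooth_nearI by blast+
  moreover note frechet_derivative_at[OF has_derivative_mult[OF
      chart_has_derivative[OF assms(2,4) V(1,2)] chart_has_derivative[OF assms(3,4) V(1,2)]]]
  ultimately show ?thesis using V by (simp add: coord_tvec_apply o_def fun_eq_iff)
qed

lemma tvec_scale:
  assumes "v \<in> tangent_space A p" "smooth_fun A U f" "p \<in> U"
  shows "v (\<lambda>q. a * f q) = a * v f"
  using tvec_mult[OF assms(1) smooth_fun_const[of U a] assms(2,3)] tvec_const[OF assms(1)]
    smooth_fun_open[OF assms(2)] by simp

lemma tvec_diff:
  assumes "v \<in> tangent_space A p" "smooth_fun A U f" "smooth_fun A U g" "p \<in> U"
  shows "v (\<lambda>q. f q - g q) = v f - v g"
  using tvec_add[OF assms(1,2) smooth_fun_mult[OF smooth_fun_const[of U "-1"] assms(3)] assms(4)]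
    tvec_scale[OF assms(1,3,4), of "-1"] smooth_fun_open[OF assms(2)] by simp

lemma smooth_fun_uminus: "smooth_fun A U f \<Longrightarrow> smooth_fun A U (\<lambda>q. - f q)"
  using smooth_fun_mult[OF smooth_fun_const[of U "-1"], of f] smooth_fun_open by simp

text \<open>Chain rule for the transition map. As a consequence one chart around p already yields
  all tangent vectors, so the tangent space is the image of a linear map and hence a
  subspace.\<close>

lemma coord_tvec_change_chart:
  assumes "(V, c) \<in> A" "p \<in> V" "(W, d) \<in> A" "p \<in> W"
  shows "coord_tvec A (W, d) p w
    = coord_tvec A (V, c) p (frechet_derivative (c \<circ> inv_into W d) (at (d p)) w)"
proof
  fix f
  let ?t = "c \<circ> inv_into W d"
  show "coord_tvec A (W, d) p w f = coord_tvec A (V, c) p (frechet_derivative ?t (at (d p)) w) f"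
  proof (cases "smooth_near A p f")
    case True
    then obtain U where U: "p \<in> U" "smooth_fun A U f" unfolding smooth_near_def by blast
    have t: "(?t has_derivative frechet_derivative ?t (at (d p))) (at (d p))"
      using smooth_on_has_derivative[OF transition_smooth[OF assms(3,1)]] assms(2,4) by blast
    have "?t (d p) = c p" using assms by simp
    then have "((f \<circ> inv_into V c) \<circ> ?t has_derivative
        frechet_derivative (f \<circ> inv_into V c) (at (c p)) \<circ> frechet_derivative ?t (at (d p))) (at (d p))"
      using diff_chain_at[OF t] chart_has_derivative[OF U(2,1) assms(1,2)] by simp
    from frechet_derivative_at[OF this]
    have "frechet_derivative ((f \<circ> inv_into V c) \<circ> ?t) (at (d p)) w
        = frechet_derivative (f \<circ> inv_into V c) (at (c p)) (frechet_derivative ?t (at (d p)) w)"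
      by (metis comp_apply)
    moreover have "frechet_derivative ((f \<circ> inv_into V c) \<circ> ?t) (at (d p))
        = frechet_derivative (f \<circ> inv_into W d) (at (d p))"
      by (rule frechet_derivative_cong_open[of "d ` (V \<inter> W)"])
         (use assms chart_image_open chart_open in auto)
    ultimately show ?thesis using True by (simp add: coord_tvec_apply)
  qed (simp add: coord_tvec_apply)
qed

lemma tangent_space_chart:
  assumes "(V, c) \<in> A" "p \<in> V"
  shows "tangent_space A p = range (coord_tvec A (V, c) p)"
  using coord_tvec_change_chart[OF assms] assms unfolding tangent_space_def by blast

lemma coord_tvec_linear:
  assumes "(V, c) \<in> A" "p \<in> V"
  shows "coord_tvec A (V, c) p (a *\<^sub>R v + b *\<^sub>R w)
    = a *\<^sub>R coord_tvec A (V, c) p v + b *\<^sub>R coord_tvec A (V, c) p w"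
proof
  fix f
  show "coord_tvec A (V, c) p (a *\<^sub>R v + b *\<^sub>R w) f
    = (a *\<^sub>R coord_tvec A (V, c) p v + b *\<^sub>R coord_tvec A (V, c) p w) f"
  proof (cases "smooth_near A p f")
    case True
    then obtain U where U: "p \<in> U" "smooth_fun A U f" unfolding smooth_near_def by blast
    interpret linear "frechet_derivative (f \<circ> inv_into V c) (at (c p))"
      using chart_has_derivative[OF U(2,1) assms] has_derivative_linear by blast
    show ?thesis using True by (simp add: coord_tvec_apply scaleR_fun_def add scale)
  qed (simp add: coord_tvec_apply scaleR_fun_def)
qed

lemma subspace_tangent_space: "subspace (tangent_space A p)"
proof -
  obtain V c where V: "(V, c) \<in> A" "p \<in> V" using chart_at by blast
  note L = coord_tvec_linear[OF V]
  have "linear (coord_tvec A (V, c) p)"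
  proof (rule linearI)
    show "coord_tvec A (V, c) p (x + y) = coord_tvec A (V, c) p x + coord_tvec A (V, c) p y" for x y
      using L[of 1 x 1 y] by simp
    show "coord_tvec A (V, c) p (a *\<^sub>R x) = a *\<^sub>R coord_tvec A (V, c) p x" for a x
      using L[of a x 0 0] by simp
  qed
  from linear_subspace_image[OF this subspace_UNIV] show ?thesis
    by (simp add: tangent_space_chart[OF V])
qed

lemmas tangent_add = subspace_add[OF subspace_tangent_space]
lemmas tangent_diff = subspace_diff[OF subspace_tangent_space]
lemmas tangent_scale = subspace_scale[OF subspace_tangent_space]
lemmas tangent_neg = subspace_neg[OF subspace_tangent_space]
lemmas tangent_zero = subspace_0[OF subspace_tangent_space]

section \<open>Smooth vector fields\<close>

lemma vfield_open: "smooth_vfield A U X \<Longrightarrow> open U"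
  unfolding smooth_vfield_def by blast

lemma vfield_tangent: "smooth_vfield A U X \<Longrightarrow> p \<in> U \<Longrightarrow> X p \<in> tangent_space A p"
  unfolding smooth_vfield_def by blast

lemma vfield_app: "smooth_vfield A U X \<Longrightarrow> smooth_fun A U f \<Longrightarrow> smooth_fun A U (app X f)"
  unfolding smooth_vfield_def by blast

lemma vfield_subset: "smooth_vfield A U X \<Longrightarrow> W \<subseteq> U \<Longrightarrow> open W \<Longrightarrow> smooth_vfield A W X"
  unfolding smooth_vfield_def by blast

lemma vfieldI:
  assumes "open U" "\<And>p. p \<in> U \<Longrightarrow> X p \<in> tangent_space A p"
    "\<And>V f. V \<subseteq> U \<Longrightarrow> smooth_fun A V f \<Longrightarrow> smooth_fun A V (app X f)"
  shows "smooth_vfield A U X"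
  using assms unfolding smooth_vfield_def by blast

lemma vfield_cong:
  assumes "smooth_vfield A U X" "\<And>q. q \<in> U \<Longrightarrow> X q = Y q"
  shows "smooth_vfield A U Y"
proof (rule vfieldI)
  show "open U" using assms(1) vfield_open by blast
  show "Y p \<in> tangent_space A p" if "p \<in> U" for p using assms vfield_tangent that by fastforce
  show "smooth_fun A V (app Y f)" if "V \<subseteq> U" "smooth_fun A V f" for V f
    by (rule smooth_fun_cong[of V "app X f"])
       (use that assms vfield_app vfield_subset smooth_fun_open in \<open>auto simp: app_def\<close>)
qed

lemma vfield_add:
  assumes "smooth_vfield A U X" "smooth_vfield A U Y" shows "smooth_vfield A U (X + Y)"
proof (rule vfieldI)
  show "smooth_fun A V (app (X + Y) f)" if "V \<subseteq> U" "smooth_fun A V f" for V f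
  proof -
    have "smooth_fun A V (app X f)" "smooth_fun A V (app Y f)"
      using vfield_app[OF vfield_subset[OF assms(1) that(1)] that(2)]
        vfield_app[OF vfield_subset[OF assms(2) that(1)] that(2)] smooth_fun_open[OF that(2)] by simp_all
    from smooth_fun_add[OF this] show ?thesis by (simp add: app_def)
  qed
  show "open U" using assms(1) vfield_open by blast
  show "(X + Y) p \<in> tangent_space A p" if "p \<in> U" for p
    using tangent_add vfield_tangent[OF assms(1) that] vfield_tangent[OF assms(2) that] by simp
qed

lemma vfield_fmult:
  assumes "smooth_fun A U k" "smooth_vfield A U X" shows "smooth_vfield A U (fmult k X)"
proof (rule vfieldI)
  show "smooth_fun A V (app (fmult k X) f)" if "V \<subseteq> U" "smooth_fun A V f" for V f
  proof -
    have "smooth_fun A V (app X f)" "smooth_fun A V k"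
      using vfield_app[OF vfield_subset[OF assms(2) that(1)] that(2)]
        smooth_fun_subset[OF assms(1) that(1)] smooth_fun_open[OF that(2)] by simp_all
    from smooth_fun_mult[OF this(2,1)] show ?thesis by (simp add: app_def fmult_def scaleR_fun_def)
  qed
  show "open U" using assms(2) vfield_open by blast
  show "fmult k X p \<in> tangent_space A p" if "p \<in> U" for p
    using tangent_scale vfield_tangent[OF assms(2) that] by (simp add: fmult_def)
qed

text \<open>The extension has constant coefficients w in one chart. Seen in another chart, its
  action on f is the derivative in direction w of the coordinate expression of f, composed with the
  transition map.\<close>

lemma tangent_vector_extends:
  assumes "v \<in> tangent_space A p"
  obtains U X where "p \<in> U" "smooth_vfield A U X" "X p = v"
proof -
  from assms obtain V c w where V: "(V, c) \<in> A" "p \<in> V" "v = coord_tvec A (V, c) p w"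
    by (rule tangent_vectorE)
  let ?X = "\<lambda>q. coord_tvec A (V, c) q w"
  have "smooth_vfield A V ?X"
  proof (rule vfieldI)
    show "open V" using chart_open V by blast
    show "?X q \<in> tangent_space A q" if "q \<in> V" for q using tangent_space_chart V(1) that by blast
    fix W f assume W: "W \<subseteq> V" "smooth_fun A W f"
    show "smooth_fun A W (app ?X f)"
    proof (rule smooth_funI[OF smooth_fun_open[OF W(2)]])
      fix V' d assume V': "(V', d) \<in> A"
      let ?S = "d ` (W \<inter> V')" and ?T = "c ` (W \<inter> V)"
      let ?h = "\<lambda>y. frechet_derivative (f \<circ> inv_into V c) (at y) w"
      have o: "open ?S" "open ?T" using V V' W chart_image_open smooth_fun_open by blast+
      have "smooth_on ?S (?h \<circ> (c \<circ> inv_into V' d))"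
      proof (rule smooth_on_compose[OF o])
        show "smooth_on ?S (c \<circ> inv_into V' d)"
          by (rule smooth_on_subset[OF transition_smooth[OF V' V(1)]]) (use W(1) in blast)
        show "smooth_on ?T ?h"
          using smooth_on_frechet_derivative[OF smooth_fun_chart[OF W(2) V(1)]] .
        show "(c \<circ> inv_into V' d) ` ?S \<subseteq> ?T" using V V' W(1) by auto
      qed
      then show "smooth_on ?S (app ?X f \<circ> inv_into V' d)"
        by (rule smooth_on_cong[OF o(1), rotated])
           (use V V' W smooth_nearI in \<open>auto simp: app_def coord_tvec_apply\<close>)
    qed
  qed
  then show ?thesis using that V by blast
qed

section \<open>The Lie bracket\<close>

lemma bracket_apply:
  "p \<in> U \<Longrightarrow> smooth_fun A U f \<Longrightarrow> bracket A X Y p f = X p (app Y f) - Y p (app X f)"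
  using smooth_nearI by (auto simp: bracket_def)

text \<open>On functions not smooth near p both brackets are 0 by convention; on the others the
  locality of tangent vectors applies on the common domain.\<close>

lemma bracket_cong:
  assumes "smooth_vfield A U X" "smooth_vfield A U Y" "\<And>q. q \<in> U \<Longrightarrow> X q = X' q"
    "\<And>q. q \<in> U \<Longrightarrow> Y q = Y' q" "p \<in> U"
  shows "bracket A X Y p = bracket A X' Y' p"
proof
  fix f
  show "bracket A X Y p f = bracket A X' Y' p f"
  proof (cases "smooth_near A p f")
    case True
    then obtain W where W: "p \<in> W" "smooth_fun A W f" unfolding smooth_near_def by blast
    let ?W = "U \<inter> W"
    have o: "open ?W" using W assms(1) smooth_fun_open vfield_open by blast
    have f: "smooth_fun A ?W f" using W o smooth_fun_subset by blast
    have pW: "p \<in> ?W" using W assms(5) by blast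
    have s: "smooth_fun A ?W (app X f)" "smooth_fun A ?W (app Y f)"
      using vfield_app[OF vfield_subset[OF assms(1) _ o] f]
        vfield_app[OF vfield_subset[OF assms(2) _ o] f] by simp_all
    have "X p (app Y f) = X p (app Y' f)"
      by (rule tvec_cong[OF vfield_tangent[OF assms(1,5)] s(2) pW]) (simp add: app_def assms(4))
    moreover have "Y p (app X f) = Y p (app X' f)"
      by (rule tvec_cong[OF vfield_tangent[OF assms(2,5)] s(1) pW]) (simp add: app_def assms(3))
    ultimately show ?thesis using assms(3,4,5) by (simp add: bracket_def)
  qed (simp add: bracket_def)
qed

lemma bracket_skew: "bracket A Y X p = - bracket A X Y p"
  by (auto simp: bracket_def fun_eq_iff)

lemma bracket_fmult_left:
  assumes "smooth_vfield A U X" "smooth_vfield A U Y" "smooth_fun A U k" "p \<in> U"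
  shows "bracket A (fmult k X) Y p = k p *\<^sub>R bracket A X Y p - app Y k p *\<^sub>R X p"
proof
  fix f
  show "bracket A (fmult k X) Y p f = (k p *\<^sub>R bracket A X Y p - app Y k p *\<^sub>R X p) f"
  proof (cases "smooth_near A p f")
    case True
    then obtain W where W: "p \<in> W" "smooth_fun A W f" unfolding smooth_near_def by blast
    let ?W = "U \<inter> W"
    have o: "open ?W" using W assms(1) smooth_fun_open vfield_open by blast
    have f: "smooth_fun A ?W f" "smooth_fun A ?W k" using W o assms smooth_fun_subset by blast+
    have X: "smooth_fun A ?W (app X f)"
      using vfield_app[OF vfield_subset[OF assms(1) _ o] f(1)] by simp
    have "app (fmult k X) f = (\<lambda>q. k q * app X f q)"
      by (auto simp: app_def fmult_def scaleR_fun_def)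
    then have "Y p (app (fmult k X) f) = k p * Y p (app X f) + Y p k * app X f p"
      using tvec_mult[OF vfield_tangent[OF assms(2,4)] f(2) X] assms(4) W(1) by simp
    then show ?thesis using True by (simp add: bracket_def scaleR_fun_def fmult_def app_def algebra_simps)
  next
    case False
    \<comment> \<open>The term with \<open>X p\<close> has to vanish on f as well; this is the
      convention that tangent vectors are 0 on functions not smooth near p.\<close>
    then show ?thesis using tvec_not_smooth[OF vfield_tangent[OF assms(1,4)] False]
      by (simp add: bracket_def scaleR_fun_def)
  qed
qed

lemma bracket_add_left:
  assumes "smooth_vfield A U X" "smooth_vfield A U X'" "smooth_vfield A U Y" "p \<in> U"
  shows "bracket A (X + X') Y p = bracket A X Y p + bracket A X' Y p"
proof
  fix f
  show "bracket A (X + X') Y p f = (bracket A X Y p + bracket A X' Y p) f"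
  proof (cases "smooth_near A p f")
    case True
    then obtain W where W: "p \<in> W" "smooth_fun A W f" unfolding smooth_near_def by blast
    let ?W = "U \<inter> W"
    have o: "open ?W" using W assms(1) smooth_fun_open vfield_open by blast
    have f: "smooth_fun A ?W f" using W o smooth_fun_subset by blast+
    have X: "smooth_fun A ?W (app X f)" "smooth_fun A ?W (app X' f)"
      using vfield_app[OF vfield_subset[OF assms(1) _ o] f]
        vfield_app[OF vfield_subset[OF assms(2) _ o] f] by simp_all
    have "app (X + X') f = (\<lambda>q. app X f q + app X' f q)" by (auto simp: app_def)
    then have "Y p (app (X + X') f) = Y p (app X f) + Y p (app X' f)"
      using tvec_add[OF vfield_tangent[OF assms(3,4)] X] assms(4) W(1) by simp
    then show ?thesis using True by (simp add: bracket_def)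
  qed (simp add: bracket_def)
qed

text \<open>The twelve iterated derivatives cancel in pairs. That the inner brackets are smooth
  fields is assumed here, so that tangent vectors may be applied to their derivatives;
  \<open>bracket_vfield\<close> supplies it later.\<close>

lemma bracket_jacobi:
  assumes X: "smooth_vfield A U X" and Y: "smooth_vfield A U Y" and Z: "smooth_vfield A U Z"
    and YZ: "smooth_vfield A U (bracket A Y Z)" and ZX: "smooth_vfield A U (bracket A Z X)"
    and XY: "smooth_vfield A U (bracket A X Y)" and p: "p \<in> U"
  shows "bracket A X (bracket A Y Z) p + bracket A Y (bracket A Z X) p
    + bracket A Z (bracket A X Y) p = 0"
proof
  fix f
  show "(bracket A X (bracket A Y Z) p + bracket A Y (bracket A Z X) p
    + bracket A Z (bracket A X Y) p) f = 0 f"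
  proof (cases "smooth_near A p f")
    case True
    then obtain W where W: "p \<in> W" "smooth_fun A W f" unfolding smooth_near_def by blast
    let ?W = "U \<inter> W"
    have pW: "p \<in> ?W" using p W by blast
    have o: "open ?W" using W X smooth_fun_open vfield_open by blast
    have f: "smooth_fun A ?W f" using W o smooth_fun_subset by blast
    have s: "smooth_fun A ?W (app E k)" if "smooth_vfield A U E" "smooth_fun A ?W k" for E k
      using vfield_app[OF vfield_subset[OF that(1) _ o] that(2)] by simp
    have br: "app (bracket A E F) f q = app E (app F f) q - app F (app E f) q" if "q \<in> ?W" for E F q
      using bracket_apply[OF that f] by (simp add: app_def)
    have ap: "G p (app (bracket A E F) f) = G p (app E (app F f)) - G p (app F (app E f))"
      if "smooth_vfield A U E" "smooth_vfield A U F" "smooth_vfield A U G"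
        "smooth_vfield A U (bracket A E F)" for E F G
      using tvec_cong[OF vfield_tangent[OF that(3) p] s[OF that(4) f] pW br]
        tvec_diff[OF vfield_tangent[OF that(3) p] s[OF that(1) s[OF that(2) f]] s[OF that(2) s[OF that(1) f]] pW]
      by simp
    have br': "bracket A E F p (app G f) = E p (app F (app G f)) - F p (app E (app G f))"
      if "smooth_vfield A U G" for E F G
      using bracket_apply[OF pW s[OF that f]] .
    show ?thesis
      unfolding plus_fun_apply zero_fun_apply bracket_apply[OF pW f] ap[OF Y Z X YZ] ap[OF Z X Y ZX] ap[OF X Y Z XY]
        br'[OF X] br'[OF Y] br'[OF Z] by simp
  qed (simp add: bracket_def)
qed

end

section \<open>Connections and curvature\<close>

locale connection_manifold = smooth_manifold A
  for A :: "('a::{t2_space, second_countable_topology}, 'n::finite) atlas" +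
  fixes D :: "'a connection"
  assumes conn: "affine_connection A D"
begin

lemma D_vfield: "smooth_vfield A U X \<Longrightarrow> smooth_vfield A U Y \<Longrightarrow> smooth_vfield A U (D X Y)"
  using conn[unfolded affine_connection_def, THEN conjunct1] by blast

lemma D_add_left:
  "smooth_vfield A U X \<Longrightarrow> smooth_vfield A U X' \<Longrightarrow> smooth_vfield A U Y \<Longrightarrow> p \<in> U \<Longrightarrow>
    D (X + X') Y p = D X Y p + D X' Y p"
  using conn[unfolded affine_connection_def, THEN conjunct2, THEN conjunct1] by blast

lemma D_add_right:
  "smooth_vfield A U X \<Longrightarrow> smooth_vfield A U Y \<Longrightarrow> smooth_vfield A U Y' \<Longrightarrow> p \<in> U \<Longrightarrow>
    D X (Y + Y') p = D X Y p + D X Y' p"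
  using conn[unfolded affine_connection_def, THEN conjunct2, THEN conjunct2, THEN conjunct1] by blast

lemma D_fmult_left:
  "smooth_fun A U k \<Longrightarrow> smooth_vfield A U X \<Longrightarrow> smooth_vfield A U Y \<Longrightarrow> p \<in> U \<Longrightarrow>
    D (fmult k X) Y p = k p *\<^sub>R D X Y p"
  using conn[unfolded affine_connection_def, THEN conjunct2, THEN conjunct2, THEN conjunct2] by blast

lemma D_fmult_right:
  "smooth_fun A U k \<Longrightarrow> smooth_vfield A U X \<Longrightarrow> smooth_vfield A U Y \<Longrightarrow> p \<in> U \<Longrightarrow>
    D X (fmult k Y) p = app X k p *\<^sub>R Y p + k p *\<^sub>R D X Y p"
  using conn[unfolded affine_connection_def, THEN conjunct2, THEN conjunct2, THEN conjunct2] by blast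

text \<open>A field vanishing on \<open>U\<close> equals its product with the indicator of the complement
  of \<open>U\<close>, which is smooth on \<open>U\<close>; so no bump functions are needed for locality.\<close>

lemma D_cong_left:
  assumes "smooth_vfield A U X" "smooth_vfield A U X'" "smooth_vfield A U Y"
    "\<And>q. q \<in> U \<Longrightarrow> X q = X' q" "p \<in> U"
  shows "D X Y p = D X' Y p"
proof -
  define Z where "Z = X' + fmult (\<lambda>_. -1) X"
  define k where "k = (\<lambda>q. if q \<in> U then 0 else 1 :: real)"
  have U: "open U" using assms(1) vfield_open by blast
  have k: "smooth_fun A U k"
    by (rule smooth_fun_cong[OF smooth_fun_const[OF U, of 0]]) (simp add: k_def)
  have Z: "smooth_vfield A U Z"
    unfolding Z_def by (intro vfield_add assms vfield_fmult smooth_fun_const U)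
  have Zk: "fmult k Z = Z"
    using assms(4) by (auto simp: fmult_def k_def Z_def)
  have "X' = X + Z" by (rule ext) (simp add: Z_def fmult_def)
  then have "D X' Y p = D X Y p + D Z Y p"
    using D_add_left[OF assms(1) Z assms(3,5)] by simp
  moreover have "D Z Y p = 0"
    using D_fmult_left[OF k Z assms(3,5)] assms(5) by (simp add: Zk) (simp add: k_def)
  ultimately show ?thesis by simp
qed

lemma D_cong_right:
  assumes "smooth_vfield A U X" "smooth_vfield A U Y" "smooth_vfield A U Y'"
    "\<And>q. q \<in> U \<Longrightarrow> Y q = Y' q" "p \<in> U"
  shows "D X Y p = D X Y' p"
proof -
  define Z where "Z = Y' + fmult (\<lambda>_. -1) Y"
  define k where "k = (\<lambda>q. if q \<in> U then 0 else 1 :: real)"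
  have U: "open U" using assms(1) vfield_open by blast
  have k: "smooth_fun A U k"
    by (rule smooth_fun_cong[OF smooth_fun_const[OF U, of 0]]) (simp add: k_def)
  have Z: "smooth_vfield A U Z"
    unfolding Z_def by (intro vfield_add assms vfield_fmult smooth_fun_const U)
  have Zk: "fmult k Z = Z"
    using assms(4) by (auto simp: fmult_def k_def Z_def)
  have Zp: "Z p = 0" using assms(4,5) by (simp add: Z_def fmult_def)
  have "Y' = Y + Z" by (rule ext) (simp add: Z_def fmult_def)
  then have "D X Y' p = D X Y p + D X Z p"
    using D_add_right[OF assms(1,2) Z assms(5)] by simp
  moreover have "D X Z p = 0"
    using D_fmult_right[OF k assms(1) Z assms(5)] assms(5) by (simp add: Zk Zp) (simp add: k_def)
  ultimately show ?thesis by simp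
qed

text \<open>The connection axioms concern the function terms built by \<open>fmult\<close> and
  \<open>+\<close>. This form also accepts a field that agrees with such a combination only on U,
  which is what bracket identities provide.\<close>

lemma D_combination_left:
  assumes "smooth_vfield A U X1" "smooth_vfield A U X2" "smooth_vfield A U Y"
    "smooth_fun A U k1" "smooth_fun A U k2" "smooth_vfield A U X"
    "\<And>q. q \<in> U \<Longrightarrow> X q = k1 q *\<^sub>R X1 q + k2 q *\<^sub>R X2 q" "p \<in> U"
  shows "D X Y p = k1 p *\<^sub>R D X1 Y p + k2 p *\<^sub>R D X2 Y p"
proof -
  have v: "smooth_vfield A U (fmult k1 X1)" "smooth_vfield A U (fmult k2 X2)"
    using vfield_fmult assms by blast+
  have "D X Y p = D (fmult k1 X1 + fmult k2 X2) Y p"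
    by (rule D_cong_left[OF assms(6) vfield_add[OF v] assms(3) _ assms(8)])
       (simp add: assms(7) fmult_def)
  then show ?thesis
    by (simp add: D_add_left[OF v assms(3,8)] D_fmult_left[OF assms(4,1,3,8)]
        D_fmult_left[OF assms(5,2,3,8)])
qed

lemma D_combination_right:
  assumes "smooth_vfield A U X" "smooth_vfield A U Y1" "smooth_vfield A U Y2"
    "smooth_fun A U k1" "smooth_fun A U k2" "smooth_vfield A U Y"
    "\<And>q. q \<in> U \<Longrightarrow> Y q = k1 q *\<^sub>R Y1 q + k2 q *\<^sub>R Y2 q" "p \<in> U"
  shows "D X Y p = app X k1 p *\<^sub>R Y1 p + k1 p *\<^sub>R D X Y1 p + app X k2 p *\<^sub>R Y2 p + k2 p *\<^sub>R D X Y2 p"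
proof -
  have v: "smooth_vfield A U (fmult k1 Y1)" "smooth_vfield A U (fmult k2 Y2)"
    using vfield_fmult assms by blast+
  have "D X Y p = D X (fmult k1 Y1 + fmult k2 Y2) p"
    by (rule D_cong_right[OF assms(1,6) vfield_add[OF v] _ assms(8)])
       (simp add: assms(7) fmult_def)
  then show ?thesis
    by (simp add: D_add_right[OF assms(1) v assms(8)] D_fmult_right[OF assms(4,1,2,8)]
        D_fmult_right[OF assms(5,1,3,8)] add.assoc)
qed

lemma D_scale_left:
  assumes "smooth_vfield A U X'" "smooth_vfield A U Y" "smooth_fun A U k" "smooth_vfield A U X"
    "\<And>q. q \<in> U \<Longrightarrow> X q = k q *\<^sub>R X' q" "p \<in> U"
  shows "D X Y p = k p *\<^sub>R D X' Y p"
  using D_combination_left[OF assms(1,1,2,3) smooth_fun_const assms(4) _ assms(6), of 0]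
    assms(5) vfield_open[OF assms(1)] by simp

lemma D_scale_right:
  assumes "smooth_vfield A U X" "smooth_vfield A U Y'" "smooth_fun A U k" "smooth_vfield A U Y"
    "\<And>q. q \<in> U \<Longrightarrow> Y q = k q *\<^sub>R Y' q" "p \<in> U"
  shows "D X Y p = app X k p *\<^sub>R Y' p + k p *\<^sub>R D X Y' p"
proof -
  have "D X Y p = D X (fmult k Y') p"
    by (rule D_cong_right[OF assms(1,4) vfield_fmult[OF assms(3,2)] _ assms(6)])
       (simp add: assms(5) fmult_def)
  then show ?thesis by (simp add: D_fmult_right[OF assms(3,1,2,6)])
qed

lemma D_zero_right:
  assumes "smooth_vfield A U X" "smooth_vfield A U Y" "\<And>q. q \<in> U \<Longrightarrow> Y q = 0" "p \<in> U"
  shows "D X Y p = 0"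
proof -
  have "D X Y p = app X (\<lambda>_. 0) p *\<^sub>R Y p + 0 *\<^sub>R D X Y p"
    by (rule D_scale_right[OF assms(1,2) smooth_fun_const[OF vfield_open[OF assms(1)]] assms(2) _ assms(4)])
       (simp add: assms(3))
  then show ?thesis using tvec_const[OF vfield_tangent[OF assms(1,4)]] by (simp add: app_def)
qed

end

section \<open>Levi-Civita connections\<close>

locale levi_civita_manifold = smooth_manifold A
  for A :: "('a::{t2_space, second_countable_topology}, 'n::finite) atlas" +
  fixes g :: "'a form2" and D :: "'a connection"
  assumes metric: "semi_riemannian_metric A g" and lc: "levi_civita A g D"
begin

sublocale connection_manifold A D
  by unfold_locales (use lc in \<open>simp add: levi_civita_def\<close>)

lemma g_sym: "v \<in> tangent_space A p \<Longrightarrow> w \<in> tangent_space A p \<Longrightarrow> g p v w = g p w v"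
  using metric[unfolded semi_riemannian_metric_def, THEN conjunct2, THEN conjunct1] by blast

lemma g_linear:
  assumes "v \<in> tangent_space A p" "x \<in> tangent_space A p" "y \<in> tangent_space A p"
  shows "g p v (a *\<^sub>R x + b *\<^sub>R y) = a * g p v x + b * g p v y"
  using metric[unfolded semi_riemannian_metric_def linear_map_on_def, THEN conjunct1] assms by simp

lemma g_nondegenerate:
  "v \<in> tangent_space A p \<Longrightarrow> (\<And>w. w \<in> tangent_space A p \<Longrightarrow> g p v w = 0) \<Longrightarrow> v = 0"
  using metric[unfolded semi_riemannian_metric_def, THEN conjunct2, THEN conjunct2, THEN conjunct1] by blast

lemma g_smooth:
  "smooth_vfield A U X \<Longrightarrow> smooth_vfield A U Y \<Longrightarrow> smooth_fun A U (ap2 g X Y)"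
  using metric[unfolded semi_riemannian_metric_def, THEN conjunct2, THEN conjunct2, THEN conjunct2] by blast

lemma g_add_right:
  "v \<in> tangent_space A p \<Longrightarrow> x \<in> tangent_space A p \<Longrightarrow> y \<in> tangent_space A p \<Longrightarrow>
    g p v (x + y) = g p v x + g p v y"
  using g_linear[of v p x y 1 1] by simp

lemma g_scale_right:
  "v \<in> tangent_space A p \<Longrightarrow> x \<in> tangent_space A p \<Longrightarrow> g p v (a *\<^sub>R x) = a * g p v x"
  using g_linear[of v p x x a 0] by simp

lemma g_neg_right:
  "v \<in> tangent_space A p \<Longrightarrow> x \<in> tangent_space A p \<Longrightarrow> g p v (- x) = - g p v x"
  using g_scale_right[of v p x "-1"] by simp

lemma g_diff_right:
  "v \<in> tangent_space A p \<Longrightarrow> x \<in> tangent_space A p \<Longrightarrow> y \<in> tangent_space A p \<Longrightarrow>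
    g p v (x - y) = g p v x - g p v y"
  using g_linear[of v p x y 1 "-1"] by simp

lemma g_zero_right: "v \<in> tangent_space A p \<Longrightarrow> g p v 0 = 0"
  using g_scale_right[of v p 0 0] tangent_zero by simp

lemma g_add_left:
  "v \<in> tangent_space A p \<Longrightarrow> x \<in> tangent_space A p \<Longrightarrow> y \<in> tangent_space A p \<Longrightarrow>
    g p (x + y) v = g p x v + g p y v"
  using g_add_right g_sym tangent_add by metis

lemma g_scale_left:
  "v \<in> tangent_space A p \<Longrightarrow> x \<in> tangent_space A p \<Longrightarrow> g p (a *\<^sub>R x) v = a * g p x v"
  using g_scale_right g_sym tangent_scale by metis

lemma g_neg_left:
  "v \<in> tangent_space A p \<Longrightarrow> x \<in> tangent_space A p \<Longrightarrow> g p (- x) v = - g p x v"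
  using g_neg_right g_sym tangent_neg by metis

lemma g_diff_left:
  "v \<in> tangent_space A p \<Longrightarrow> x \<in> tangent_space A p \<Longrightarrow> y \<in> tangent_space A p \<Longrightarrow>
    g p (x - y) v = g p x v - g p y v"
  using g_diff_right g_sym tangent_diff by metis

lemma g_zero_left: "v \<in> tangent_space A p \<Longrightarrow> g p 0 v = 0"
  using g_zero_right g_sym tangent_zero by metis

lemmas g_simps = g_add_right g_scale_right g_neg_right g_diff_right g_zero_right
  g_add_left g_scale_left g_neg_left g_diff_left g_zero_left
lemmas tangent_simps = tangent_add tangent_diff tangent_scale tangent_neg tangent_zero

lemma D_torsion:
  "smooth_vfield A U X \<Longrightarrow> smooth_vfield A U Y \<Longrightarrow> p \<in> U \<Longrightarrow> D X Y p - D Y X p = bracket A X Y p"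
  using lc[unfolded levi_civita_def, THEN conjunct2, THEN conjunct1] by blast

lemma D_metric:
  "smooth_vfield A U X \<Longrightarrow> smooth_vfield A U Y \<Longrightarrow> smooth_vfield A U Z \<Longrightarrow> p \<in> U \<Longrightarrow>
    X p (ap2 g Y Z) = g p (D X Y p) (Z p) + g p (Y p) (D X Z p)"
  using lc[unfolded levi_civita_def, THEN conjunct2, THEN conjunct2] by (simp add: app_def ap2_def)

text \<open>A constant inner product has derivative 0, so the metric condition leaves the two
  connection terms. All inner products of frame fields are of this kind.\<close>

lemma D_metric_const:
  assumes "smooth_vfield A U X" "smooth_vfield A U Y" "smooth_vfield A U Z" "p \<in> U"
    "\<And>q. q \<in> U \<Longrightarrow> g q (Y q) (Z q) = a"
  shows "g p (D X Y p) (Z p) + g p (Y p) (D X Z p) = 0"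
proof -
  have "X p (ap2 g Y Z) = X p (\<lambda>_. a)"
    by (rule tvec_cong[OF vfield_tangent[OF assms(1,4)] g_smooth[OF assms(2,3)] assms(4)])
       (simp add: ap2_def assms(5))
  then show ?thesis using D_metric[OF assms(1-4)] tvec_const[OF vfield_tangent[OF assms(1,4)]] by simp
qed

text \<open>Torsion-freeness identifies the bracket on U with \<open>D X Y - D Y X\<close>, whose
  smoothness is part of the connection axioms; this replaces a chart computation with second
  derivatives.\<close>

lemma bracket_vfield:
  assumes "smooth_vfield A U X" "smooth_vfield A U Y" shows "smooth_vfield A U (bracket A X Y)"
proof (rule vfield_cong)
  show "smooth_vfield A U (D X Y + fmult (\<lambda>_. -1) (D Y X))"
    using assms vfield_open by (intro vfield_add vfield_fmult D_vfield smooth_fun_const) blast+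
  show "(D X Y + fmult (\<lambda>_. -1) (D Y X)) q = bracket A X Y q" if "q \<in> U" for q
    using D_torsion[OF assms that] by (simp add: fmult_def)
qed

section \<open>Tensoriality and symmetries of the curvature\<close>

lemma curvature_tangent:
  assumes "smooth_vfield A U X" "smooth_vfield A U Y" "smooth_vfield A U Z" "p \<in> U"
  shows "curvature A D X Y Z p \<in> tangent_space A p"
proof -
  have "smooth_vfield A U (D X (D Y Z))" "smooth_vfield A U (D Y (D X Z))"
    "smooth_vfield A U (D (bracket A X Y) Z)"
    using D_vfield[OF assms(1) D_vfield[OF assms(2,3)]] D_vfield[OF assms(2) D_vfield[OF assms(1,3)]]
      D_vfield[OF bracket_vfield[OF assms(1,2)] assms(3)] by simp_all
  then have "D X (D Y Z) p \<in> tangent_space A p" "D Y (D X Z) p \<in> tangent_space A p"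
    "D (bracket A X Y) Z p \<in> tangent_space A p"
    using vfield_tangent assms(4) by blast+
  then show ?thesis by (simp add: curvature_def tangent_simps)
qed

lemma curvature_apply:
  "curvature A D X Y Z p = D X (D Y Z) p - D Y (D X Z) p - D (bracket A X Y) Z p"
  by (simp add: curvature_def)

lemma curvature_skew:
  assumes "smooth_vfield A U X" "smooth_vfield A U Y" "smooth_vfield A U Z" "p \<in> U"
  shows "curvature A D Y X Z p = - curvature A D X Y Z p"
proof -
  have "D (bracket A Y X) Z p = (-1) *\<^sub>R D (bracket A X Y) Z p"
    by (rule D_scale_left[OF bracket_vfield[OF assms(1,2)] assms(3) smooth_fun_const[OF vfield_open[OF assms(1)]]
       bracket_vfield[OF assms(2,1)] _ assms(4)]) (simp add: bracket_skew[of X])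
  then show ?thesis by (simp add: curvature_apply)
qed

lemma curvature_cong_left:
  assumes "smooth_vfield A U X" "smooth_vfield A U X'" "smooth_vfield A U Y" "smooth_vfield A U Z"
    "\<And>q. q \<in> U \<Longrightarrow> X q = X' q" "p \<in> U"
  shows "curvature A D X Y Z p = curvature A D X' Y Z p"
proof -
  note X = assms(1) and X' = assms(2) and Y = assms(3) and Z = assms(4) and p = assms(6)
  have "D X (D Y Z) p = D X' (D Y Z) p"
    by (rule D_cong_left[OF X X' D_vfield[OF Y Z] assms(5) p])
  moreover have "D Y (D X Z) p = D Y (D X' Z) p"
    by (rule D_cong_right[OF Y D_vfield[OF X Z] D_vfield[OF X' Z] D_cong_left[OF X X' Z assms(5)] p])
  moreover have "D (bracket A X Y) Z p = D (bracket A X' Y) Z p"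
    by (rule D_cong_left[OF bracket_vfield[OF X Y] bracket_vfield[OF X' Y] Z _ p],
        rule bracket_cong[OF X Y assms(5)]) simp_all
  ultimately show ?thesis by (simp add: curvature_apply)
qed

lemma curvature_cong_right:
  assumes "smooth_vfield A U X" "smooth_vfield A U Y" "smooth_vfield A U Z" "smooth_vfield A U Z'"
    "\<And>q. q \<in> U \<Longrightarrow> Z q = Z' q" "p \<in> U"
  shows "curvature A D X Y Z p = curvature A D X Y Z' p"
proof -
  note X = assms(1) and Y = assms(2) and Z = assms(3) and Z' = assms(4) and p = assms(6)
  have "D X (D Y Z) p = D X (D Y Z') p"
    by (rule D_cong_right[OF X D_vfield[OF Y Z] D_vfield[OF Y Z'] D_cong_right[OF Y Z Z' assms(5)] p])
  moreover have "D Y (D X Z) p = D Y (D X Z') p"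
    by (rule D_cong_right[OF Y D_vfield[OF X Z] D_vfield[OF X Z'] D_cong_right[OF X Z Z' assms(5)] p])
  moreover have "D (bracket A X Y) Z p = D (bracket A X Y) Z' p"
    by (rule D_cong_right[OF bracket_vfield[OF X Y] Z Z' assms(5) p])
  ultimately show ?thesis by (simp add: curvature_apply)
qed

text \<open>Differentiating the coefficient k inside the second term produces a multiple of
  \<open>D X Z p\<close>, which the derivative term of the bracket of \<open>fmult k X\<close> and Y
  cancels.\<close>

lemma curvature_fmult_left:
  assumes "smooth_fun A U k" "smooth_vfield A U X" "smooth_vfield A U Y" "smooth_vfield A U Z" "p \<in> U"
  shows "curvature A D (fmult k X) Y Z p = k p *\<^sub>R curvature A D X Y Z p"
proof -
  note k = assms(1) and X = assms(2) and Y = assms(3) and Z = assms(4) and p = assms(5)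
  have kX: "smooth_vfield A U (fmult k X)" using vfield_fmult k X by blast
  have "D (fmult k X) (D Y Z) p = k p *\<^sub>R D X (D Y Z) p"
    by (rule D_fmult_left[OF k X D_vfield[OF Y Z] p])
  moreover have "D Y (D (fmult k X) Z) p = app Y k p *\<^sub>R D X Z p + k p *\<^sub>R D Y (D X Z) p"
    by (rule D_scale_right[OF Y D_vfield[OF X Z] k D_vfield[OF kX Z] D_fmult_left[OF k X Z] p])
  moreover have "D (bracket A (fmult k X) Y) Z p
      = k p *\<^sub>R D (bracket A X Y) Z p + (- app Y k p) *\<^sub>R D X Z p"
    by (rule D_combination_left[OF bracket_vfield[OF X Y] X Z k
          smooth_fun_uminus[OF vfield_app[OF Y k]] bracket_vfield[OF kX Y] _ p])
       (simp add: bracket_fmult_left[OF X Y k])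
  ultimately show ?thesis by (simp add: curvature_apply algebra_simps)
qed

lemma curvature_add_left:
  assumes "smooth_vfield A U X" "smooth_vfield A U X'" "smooth_vfield A U Y" "smooth_vfield A U Z" "p \<in> U"
  shows "curvature A D (X + X') Y Z p = curvature A D X Y Z p + curvature A D X' Y Z p"
proof -
  note X = assms(1) and X' = assms(2) and Y = assms(3) and Z = assms(4) and p = assms(5)
  note XX = vfield_add[OF X X']
  have "D (X + X') (D Y Z) p = D X (D Y Z) p + D X' (D Y Z) p"
    by (rule D_add_left[OF X X' D_vfield[OF Y Z] p])
  moreover have "D Y (D (X + X') Z) p = D Y (D X Z + D X' Z) p"
    by (rule D_cong_right[OF Y D_vfield[OF XX Z] vfield_add[OF D_vfield[OF X Z] D_vfield[OF X' Z]] _ p])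
       (simp add: D_add_left[OF X X' Z])
  moreover have "D Y (D X Z + D X' Z) p = D Y (D X Z) p + D Y (D X' Z) p"
    by (rule D_add_right[OF Y D_vfield[OF X Z] D_vfield[OF X' Z] p])
  moreover have "D (bracket A (X + X') Y) Z p = D (bracket A X Y + bracket A X' Y) Z p"
    by (rule D_cong_left[OF bracket_vfield[OF XX Y]
          vfield_add[OF bracket_vfield[OF X Y] bracket_vfield[OF X' Y]] Z _ p])
       (simp add: bracket_add_left[OF X X' Y])
  moreover have "D (bracket A X Y + bracket A X' Y) Z p = D (bracket A X Y) Z p + D (bracket A X' Y) Z p"
    by (rule D_add_left[OF bracket_vfield[OF X Y] bracket_vfield[OF X' Y] Z p])
  ultimately show ?thesis by (simp add: curvature_apply)
qed

text \<open>The first derivatives of k occur symmetrically in X and Y and cancel; the second ones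
  add up to the derivative of k along [X, Y], which the bracket term removes.\<close>

lemma curvature_fmult_right:
  assumes "smooth_fun A U k" "smooth_vfield A U X" "smooth_vfield A U Y" "smooth_vfield A U Z" "p \<in> U"
  shows "curvature A D X Y (fmult k Z) p = k p *\<^sub>R curvature A D X Y Z p"
proof -
  note k = assms(1) and X = assms(2) and Y = assms(3) and Z = assms(4) and p = assms(5)
  have kZ: "smooth_vfield A U (fmult k Z)" using vfield_fmult k Z by blast
  have second: "D E (D F (fmult k Z)) p = app E (app F k) p *\<^sub>R Z p + app F k p *\<^sub>R D E Z p
      + app E k p *\<^sub>R D F Z p + k p *\<^sub>R D E (D F Z) p"
    if E: "smooth_vfield A U E" and F: "smooth_vfield A U F" for E F
    by (rule D_combination_right[OF E Z D_vfield[OF F Z] vfield_app[OF F k] k D_vfield[OF F kZ]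
          D_fmult_right[OF k F Z] p])
  have "D (bracket A X Y) (fmult k Z) p
      = (app X (app Y k) p - app Y (app X k) p) *\<^sub>R Z p + k p *\<^sub>R D (bracket A X Y) Z p"
    using D_fmult_right[OF k bracket_vfield[OF X Y] Z p] bracket_apply[OF p k]
    by (simp add: app_def)
  then show ?thesis by (simp add: curvature_apply second[OF X Y] second[OF Y X] algebra_simps)
qed

lemma curvature_add_right:
  assumes "smooth_vfield A U X" "smooth_vfield A U Y" "smooth_vfield A U Z" "smooth_vfield A U Z'" "p \<in> U"
  shows "curvature A D X Y (Z + Z') p = curvature A D X Y Z p + curvature A D X Y Z' p"
proof -
  note X = assms(1) and Y = assms(2) and Z = assms(3) and Z' = assms(4) and p = assms(5)
  note ZZ = vfield_add[OF Z Z']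
  have second: "D E (D F (Z + Z')) p = D E (D F Z) p + D E (D F Z') p"
    if E: "smooth_vfield A U E" and F: "smooth_vfield A U F" for E F
  proof -
    have "D E (D F (Z + Z')) p = D E (D F Z + D F Z') p"
      by (rule D_cong_right[OF E D_vfield[OF F ZZ] vfield_add[OF D_vfield[OF F Z] D_vfield[OF F Z']] _ p])
         (simp add: D_add_right[OF F Z Z'])
    then show ?thesis by (simp add: D_add_right[OF E D_vfield[OF F Z] D_vfield[OF F Z'] p])
  qed
  have "D (bracket A X Y) (Z + Z') p = D (bracket A X Y) Z p + D (bracket A X Y) Z' p"
    by (rule D_add_right[OF bracket_vfield[OF X Y] Z Z' p])
  then show ?thesis by (simp add: curvature_apply second[OF X Y] second[OF Y X])
qed

text \<open>After regrouping the cyclic sum, torsion-freeness turns each group into a double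
  bracket, and the Jacobi identity finishes.\<close>

lemma curvature_bianchi:
  assumes "smooth_vfield A U X" "smooth_vfield A U Y" "smooth_vfield A U Z" "p \<in> U"
  shows "curvature A D X Y Z p + curvature A D Y Z X p + curvature A D Z X Y p = 0"
proof -
  note X = assms(1) and Y = assms(2) and Z = assms(3) and p = assms(4)
  have cyc: "D E (D F G) p - D E (D G F) p - D (bracket A F G) E p = bracket A E (bracket A F G) p"
    if E: "smooth_vfield A U E" and F: "smooth_vfield A U F" and G: "smooth_vfield A U G" for E F G
  proof -
    have "D E (D F G) p = D E (D G F + bracket A F G) p"
      by (rule D_cong_right[OF E D_vfield[OF F G] vfield_add[OF D_vfield[OF G F] bracket_vfield[OF F G]] _ p])
         (simp flip: D_torsion[OF F G])
    also have "\<dots> = D E (D G F) p + D E (bracket A F G) p"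
      by (rule D_add_right[OF E D_vfield[OF G F] bracket_vfield[OF F G] p])
    finally show ?thesis using D_torsion[OF E bracket_vfield[OF F G] p] by simp
  qed
  have "curvature A D X Y Z p + curvature A D Y Z X p + curvature A D Z X Y p
    = (D X (D Y Z) p - D X (D Z Y) p - D (bracket A Y Z) X p)
      + (D Y (D Z X) p - D Y (D X Z) p - D (bracket A Z X) Y p)
      + (D Z (D X Y) p - D Z (D Y X) p - D (bracket A X Y) Z p)"
    by (simp add: curvature_apply)
  also have "\<dots> = 0"
    unfolding cyc[OF X Y Z] cyc[OF Y Z X] cyc[OF Z X Y]
    by (rule bracket_jacobi[OF X Y Z bracket_vfield[OF Y Z] bracket_vfield[OF Z X] bracket_vfield[OF X Y] p])
  finally show ?thesis .
qed

text \<open>The commutator of X and Y on the function g(Z, W) equals its derivative along [X, Y].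
  Expanding both by the metric condition, mixed products such as g(D_X Z, D_Y W) cancel by
  antisymmetry in X and Y.\<close>

lemma curvature_metric_skew:
  assumes "smooth_vfield A U X" "smooth_vfield A U Y" "smooth_vfield A U Z" "smooth_vfield A U W" "p \<in> U"
  shows "g p (curvature A D X Y Z p) (W p) + g p (Z p) (curvature A D X Y W p) = 0"
proof -
  note X = assms(1) and Y = assms(2) and Z = assms(3) and W = assms(4) and p = assms(5)
  let ?k = "ap2 g Z W"
  have second: "E p (app F ?k) = g p (D E (D F Z) p) (W p) + g p (D F Z p) (D E W p)
      + g p (D E Z p) (D F W p) + g p (Z p) (D E (D F W) p)"
    if E: "smooth_vfield A U E" and F: "smooth_vfield A U F" for E F
  proof -
    have "E p (app F ?k) = E p (\<lambda>q. ap2 g (D F Z) W q + ap2 g Z (D F W) q)"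
      by (rule tvec_cong[OF vfield_tangent[OF E p] vfield_app[OF F g_smooth[OF Z W]] p])
         (simp add: app_def ap2_def[of g "D F Z"] ap2_def[of g Z "D F W"] D_metric[OF F Z W])
    also have "\<dots> = E p (ap2 g (D F Z) W) + E p (ap2 g Z (D F W))"
      by (rule tvec_add[OF vfield_tangent[OF E p] g_smooth[OF D_vfield[OF F Z] W]
            g_smooth[OF Z D_vfield[OF F W]] p])
    finally show ?thesis
      by (simp add: D_metric[OF E D_vfield[OF F Z] W p] D_metric[OF E Z D_vfield[OF F W] p])
  qed
  have "bracket A X Y p ?k = g p (D (bracket A X Y) Z p) (W p) + g p (Z p) (D (bracket A X Y) W p)"
    by (rule D_metric[OF bracket_vfield[OF X Y] Z W p])
  then have key: "g p (D (bracket A X Y) Z p) (W p) + g p (Z p) (D (bracket A X Y) W p)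
      = X p (app Y ?k) - Y p (app X ?k)"
    using bracket_apply[OF p g_smooth[OF Z W]] by simp
  have T: "D E (D F G) p \<in> tangent_space A p" "D (bracket A E F) G p \<in> tangent_space A p"
    "G p \<in> tangent_space A p"
    if "smooth_vfield A U E" "smooth_vfield A U F" "smooth_vfield A U G" for E F G
    using vfield_tangent[OF _ p] D_vfield[OF that(1) D_vfield[OF that(2,3)]]
      D_vfield[OF bracket_vfield[OF that(1,2)] that(3)] that(3) by blast+
  show ?thesis
    using key unfolding second[OF X Y] second[OF Y X]
    by (simp add: curvature_apply g_simps tangent_simps T[OF X Y Z] T[OF X Y W] T[OF Y X Z] T[OF Y X W])
qed

end

section \<open>Para-Sasakian 3-manifolds\<close>

locale para_sasakian_3manifold = levi_civita_manifold A g D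
  for A :: "('a::{t2_space, second_countable_topology}, 'n::finite) atlas" and g D +
  fixes \<phi> :: "'a endo_field" and \<zeta> :: "'a vfield" and \<eta> :: "'a form1"
  assumes ps: "para_sasakian 1 A \<phi> \<zeta> \<eta> g"
begin

section \<open>Pointwise algebra of the structure tensors\<close>

lemma apc: "almost_paracontact_metric 1 A \<phi> \<zeta> \<eta> g"
  using ps unfolding para_sasakian_def paracontact_metric_def by blast

lemmas apc_rules = apc[unfolded almost_paracontact_metric_def]

lemma phi_endo: "smooth_endo_field A \<phi>" and zeta_vfield: "smooth_vfield A UNIV \<zeta>"
  and eta_form: "smooth_form1 A \<eta>"
  using apc_rules by simp_all

lemma phi_square: "v \<in> tangent_space A p \<Longrightarrow> \<phi> p (\<phi> p v) = v - \<eta> p v *\<^sub>R \<zeta> p"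
  and eta_zeta: "\<eta> p (\<zeta> p) = 1"
  and phi_compatible: "v \<in> tangent_space A p \<Longrightarrow> w \<in> tangent_space A p \<Longrightarrow>
    g p (\<phi> p v) (\<phi> p w) = - g p v w + \<eta> p v * \<eta> p w"
  and dim_eigenspaces: "dim {v \<in> tangent_space A p. \<eta> p v = 0 \<and> \<phi> p v = v} = 1"
    "dim {v \<in> tangent_space A p. \<eta> p v = 0 \<and> \<phi> p v = - v} = 1"
  using apc_rules by simp_all

lemma ap_endo_apply: "ap_endo \<phi> X q = \<phi> q (X q)"
  by (simp add: ap_endo_def)

lemma phi_tangent: "v \<in> tangent_space A p \<Longrightarrow> \<phi> p v \<in> tangent_space A p"
  using phi_endo[unfolded smooth_endo_field_def, THEN conjunct1] by blast

lemma zeta_tangent: "\<zeta> p \<in> tangent_space A p"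
  using vfield_tangent[OF zeta_vfield] by simp

lemma phi_linear:
  "x \<in> tangent_space A p \<Longrightarrow> y \<in> tangent_space A p \<Longrightarrow>
    \<phi> p (a *\<^sub>R x + b *\<^sub>R y) = a *\<^sub>R \<phi> p x + b *\<^sub>R \<phi> p y"
  using phi_endo[unfolded smooth_endo_field_def linear_map_on_def, THEN conjunct1] by simp

lemma eta_linear:
  "x \<in> tangent_space A p \<Longrightarrow> y \<in> tangent_space A p \<Longrightarrow>
    \<eta> p (a *\<^sub>R x + b *\<^sub>R y) = a * \<eta> p x + b * \<eta> p y"
  using eta_form[unfolded smooth_form1_def linear_map_on_def, THEN conjunct1] by simp

lemma phi_scale: "x \<in> tangent_space A p \<Longrightarrow> \<phi> p (a *\<^sub>R x) = a *\<^sub>R \<phi> p x"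
  using phi_linear[of x p x a 0] by simp

lemma phi_add: "x \<in> tangent_space A p \<Longrightarrow> y \<in> tangent_space A p \<Longrightarrow> \<phi> p (x + y) = \<phi> p x + \<phi> p y"
  using phi_linear[of x p y 1 1] by simp

lemma phi_neg: "x \<in> tangent_space A p \<Longrightarrow> \<phi> p (- x) = - \<phi> p x"
  using phi_scale[of x p "-1"] by simp

lemma phi_diff: "x \<in> tangent_space A p \<Longrightarrow> y \<in> tangent_space A p \<Longrightarrow> \<phi> p (x - y) = \<phi> p x - \<phi> p y"
  using phi_linear[of x p y 1 "-1"] by simp

lemma phi_zero: "\<phi> p 0 = 0"
  using phi_scale[OF tangent_zero, of p 0] by simp

lemma eta_scale: "x \<in> tangent_space A p \<Longrightarrow> \<eta> p (a *\<^sub>R x) = a * \<eta> p x"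
  using eta_linear[of x p x a 0] by simp

text \<open>\<open>\<phi>\<close> squared kills \<open>\<zeta>\<close>, so \<open>phi_square\<close>
  at \<open>\<phi> p (\<zeta> p)\<close> makes that vector a multiple c of \<open>\<zeta> p\<close>.
  Applying \<open>\<phi>\<close> once more gives c^2 = 0.\<close>

lemma phi_zeta: "\<phi> p (\<zeta> p) = 0"
proof -
  define c where "c = \<eta> p (\<phi> p (\<zeta> p))"
  have "\<phi> p (\<phi> p (\<zeta> p)) = 0" using phi_square[OF zeta_tangent] eta_zeta by simp
  then have c: "\<phi> p (\<zeta> p) = c *\<^sub>R \<zeta> p" 
    using phi_square[OF phi_tangent[OF zeta_tangent], of p] phi_zero by (simp add: c_def)
  then have "c *\<^sub>R c *\<^sub>R \<zeta> p = 0"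
    using \<open>\<phi> p (\<phi> p (\<zeta> p)) = 0\<close> phi_scale[OF zeta_tangent] by metis
  moreover have "\<zeta> p \<noteq> 0" using eta_zeta[of p] eta_scale[OF zeta_tangent, of p 0] by auto
  ultimately show ?thesis using c by simp
qed

lemma phi_cube: "v \<in> tangent_space A p \<Longrightarrow> \<phi> p (\<phi> p (\<phi> p v)) = \<phi> p v"
  using phi_square[of v p] phi_diff[OF _ tangent_scale[OF zeta_tangent]] phi_scale[OF zeta_tangent]
  by (simp add: phi_zeta)

lemma eta_phi:
  assumes "v \<in> tangent_space A p" shows "\<eta> p (\<phi> p v) = 0"
proof -
  have "\<zeta> p \<noteq> 0" using eta_zeta[of p] eta_scale[OF zeta_tangent, of p 0] by auto
  then show ?thesis using phi_square[OF phi_tangent[OF assms]] phi_cube[OF assms] by simp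
qed

lemma g_zeta:
  assumes "v \<in> tangent_space A p" shows "g p v (\<zeta> p) = \<eta> p v"
  using phi_compatible[OF assms zeta_tangent] g_zero_right[OF phi_tangent[OF assms]]
  by (simp add: phi_zeta eta_zeta)

text \<open>Compatibility is applied to v and \<open>\<phi> p w\<close>. The square of
  \<open>\<phi>\<close> changes w only by a multiple of \<open>\<zeta> p\<close>, to which
  \<open>\<phi> p v\<close> is orthogonal.\<close>

lemma g_phi_skew:
  assumes "v \<in> tangent_space A p" "w \<in> tangent_space A p"
  shows "g p (\<phi> p v) w = - g p v (\<phi> p w)"
proof -
  have "g p (\<phi> p v) (w - \<eta> p w *\<^sub>R \<zeta> p) = - g p v (\<phi> p w)"
    using phi_compatible[OF assms(1) phi_tangent[OF assms(2)]] phi_square[OF assms(2)] eta_phi[OF assms(2)]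
    by simp
  then show ?thesis
    using assms zeta_tangent eta_phi g_zeta phi_tangent by (simp add: g_simps tangent_simps)
qed

text \<open>The vector \<open>?z\<close> is the component of x in ker \<open>\<eta>\<close>; half
  the sum and half the difference of \<open>?z\<close> and \<open>?y\<close> are its projections to
  the two eigenlines, each spanned by any nonzero member.\<close>

lemma eigenvector_decomposition:
  assumes "u \<in> tangent_space A q" "\<phi> q u = u" "u \<noteq> 0"
    and "w \<in> tangent_space A q" "\<phi> q w = - w" "w \<noteq> 0" and x: "x \<in> tangent_space A q"
  obtains s t where "x = \<eta> q x *\<^sub>R \<zeta> q + (s *\<^sub>R u + t *\<^sub>R w)"
proof -
  let ?y = "\<phi> q x" and ?z = "\<phi> q (\<phi> q x)"
  let ?E = "{v \<in> tangent_space A q. \<eta> q v = 0 \<and> \<phi> q v = v}"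
  let ?F = "{v \<in> tangent_space A q. \<eta> q v = 0 \<and> \<phi> q v = - v}"
  have yz: "?y \<in> tangent_space A q" "?z \<in> tangent_space A q" using phi_tangent x by simp_all
  have pz: "\<phi> q ?z = ?y" by (rule phi_cube[OF x])
  have eta: "\<eta> q ?y = 0" "\<eta> q ?z = 0" using eta_phi x yz by simp_all
  have "u \<in> ?E" using assms(1,2) eta_phi[OF assms(1)] by simp
  moreover have "(1/2) *\<^sub>R (?y + ?z) \<in> ?E"
    using yz eta pz eta_linear[OF yz, of "1/2" "1/2"]
    by (simp add: phi_scale phi_add scaleR_add_right add.commute tangent_add tangent_scale)
  ultimately obtain s where s: "(1/2) *\<^sub>R (?y + ?z) = s *\<^sub>R u"
    using dim_one_scaleR[OF dim_eigenspaces(1)[of q]] assms(3) by blast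
  have "w \<in> ?F"
    using assms(4,5) eta_phi[OF assms(4)] eta_scale[OF assms(4), of "-1"] by simp
  moreover have "(1/2) *\<^sub>R (?z - ?y) \<in> ?F"
    using yz eta pz eta_linear[OF yz(2,1), of "1/2" "-1/2"]
    by (simp add: phi_scale phi_diff scaleR_diff_right tangent_diff tangent_scale)
  ultimately obtain t where t: "(1/2) *\<^sub>R (?z - ?y) = t *\<^sub>R w"
    using dim_one_scaleR[OF dim_eigenspaces(2)[of q]] assms(6) by blast
  have "?z = (1/2) *\<^sub>R (?y + ?z) + (1/2) *\<^sub>R (?z - ?y)"
  proof -
    have "?y + ?z + (?z - ?y) = 2 *\<^sub>R ?z" unfolding scaleR_2 by simp
    then show ?thesis unfolding scaleR_add_right[symmetric] by simp
  qed
  then have "?z = s *\<^sub>R u + t *\<^sub>R w" using s t by simp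
  moreover have "x = \<eta> q x *\<^sub>R \<zeta> q + ?z" using phi_square[OF x] by simp
  ultimately show ?thesis using that by simp
qed

lemma phi_vfield: "smooth_vfield A U X \<Longrightarrow> smooth_vfield A U (ap_endo \<phi> X)"
  using phi_endo[unfolded smooth_endo_field_def, THEN conjunct2] by blast

lemma eta_smooth: "smooth_vfield A U X \<Longrightarrow> smooth_fun A U (ap1 \<eta> X)"
  using eta_form[unfolded smooth_form1_def, THEN conjunct2] by blast

lemma d_eta:
  assumes "smooth_vfield A U X" "smooth_vfield A U Y" "p \<in> U"
  shows "ext_deriv A \<eta> X Y p = g p (X p) (\<phi> p (Y p))"
  using ps assms unfolding para_sasakian_def paracontact_metric_def ap2_def ap_endo_def by blast

text \<open>For constant \<open>\<eta>(X)\<close> and \<open>\<eta>(Y)\<close> the derivative terms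
  of \<open>2 d\<eta>\<close> vanish, so the contact condition evaluates \<open>\<eta>\<close> on
  the bracket.\<close>

lemma eta_bracket:
  assumes "smooth_vfield A U X" "smooth_vfield A U Y" "p \<in> U"
    "\<And>q. q \<in> U \<Longrightarrow> \<eta> q (X q) = a" "\<And>q. q \<in> U \<Longrightarrow> \<eta> q (Y q) = b"
  shows "\<eta> p (bracket A X Y p) = - 2 * g p (X p) (\<phi> p (Y p))"
proof -
  have const: "E p (ap1 \<eta> F) = 0"
    if E: "smooth_vfield A U E" and F: "smooth_vfield A U F" and c: "\<And>q. q \<in> U \<Longrightarrow> \<eta> q (F q) = c" for E F c
  proof -
    have "E p (ap1 \<eta> F) = E p (\<lambda>_. c)"
      by (rule tvec_cong[OF vfield_tangent[OF E assms(3)] eta_smooth[OF F] assms(3)]) (simp add: ap1_def c)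
    then show ?thesis using tvec_const[OF vfield_tangent[OF E assms(3)]] by simp
  qed
  show ?thesis
    using d_eta[OF assms(1-3)] const[OF assms(1,2,5)] const[OF assms(2,1,4)]
    by (simp add: ext_deriv_def app_def ap1_def[of \<eta> "bracket A X Y"])
qed

lemma normality:
  assumes "smooth_vfield A U X" "smooth_vfield A U Y" "p \<in> U"
  shows "nijenhuis A \<phi> X Y p = (2 * g p (X p) (\<phi> p (Y p))) *\<^sub>R \<zeta> p"
proof -
  have "nijenhuis A \<phi> X Y p - (2 * ext_deriv A \<eta> X Y p) *\<^sub>R \<zeta> p = 0"
    using ps assms unfolding para_sasakian_def normal_structure_def by blast
  then show ?thesis using d_eta[OF assms] by simp
qed

end

section \<open>Null frames adapted to the structure\<close>

locale para_sasakian_frame = para_sasakian_3manifold A g D \<phi> \<zeta> \<eta>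
  for A :: "('a::{t2_space, second_countable_topology}, 'n::finite) atlas" and g D \<phi> \<zeta> \<eta> +
  fixes U :: "'a set" and P Q :: "'a vfield"
  assumes vP [simp]: "smooth_vfield A U P" and vQ [simp]: "smooth_vfield A U Q"
    and phi_P [simp]: "\<And>q. q \<in> U \<Longrightarrow> \<phi> q (P q) = P q"
    and phi_Q [simp]: "\<And>q. q \<in> U \<Longrightarrow> \<phi> q (Q q) = - Q q"
    and g_PQ [simp]: "\<And>q. q \<in> U \<Longrightarrow> g q (P q) (Q q) = 1"
begin

lemma U_open [simp]: "open U" using vfield_open vP by blast

lemma vZ [simp]: "smooth_vfield A U \<zeta>" by (rule vfield_subset[OF zeta_vfield]) simp_all

lemma frame_tangent [simp]: "q \<in> U \<Longrightarrow> smooth_vfield A U X \<Longrightarrow> X q \<in> tangent_space A q"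
  using vfield_tangent by blast

lemmas [simp] = tangent_simps D_vfield bracket_vfield

lemma g_QP [simp]: "q \<in> U \<Longrightarrow> g q (Q q) (P q) = 1"
  using g_sym[of "Q q" q "P q"] by simp

lemma eta_P [simp]: "q \<in> U \<Longrightarrow> \<eta> q (P q) = 0" and eta_Q [simp]: "q \<in> U \<Longrightarrow> \<eta> q (Q q) = 0"
proof -
  assume q: "q \<in> U"
  show "\<eta> q (P q) = 0" using eta_phi[of "P q" q] q by simp
  show "\<eta> q (Q q) = 0" using eta_phi[of "Q q" q] eta_scale[of "Q q" q "-1"] q by simp
qed

lemma g_PZ [simp]: "q \<in> U \<Longrightarrow> g q (P q) (\<zeta> q) = 0" and g_QZ [simp]: "q \<in> U \<Longrightarrow> g q (Q q) (\<zeta> q) = 0"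
  and g_ZZ [simp]: "q \<in> U \<Longrightarrow> g q (\<zeta> q) (\<zeta> q) = 1"
  using g_zeta eta_zeta by simp_all

lemma g_ZP [simp]: "q \<in> U \<Longrightarrow> g q (\<zeta> q) (P q) = 0" and g_ZQ [simp]: "q \<in> U \<Longrightarrow> g q (\<zeta> q) (Q q) = 0"
  using g_sym[of "\<zeta> q" q "P q"] g_sym[of "\<zeta> q" q "Q q"] by simp_all

text \<open>Skewness makes eigenvectors null: g(P,P) = g(\<phi>P,P) = - g(P,\<phi>P) = - g(P,P), and
  likewise for Q.\<close>

lemma g_PP [simp]: "q \<in> U \<Longrightarrow> g q (P q) (P q) = 0" and g_QQ [simp]: "q \<in> U \<Longrightarrow> g q (Q q) (Q q) = 0"
  using g_phi_skew[of "P q" q "P q"] g_phi_skew[of "Q q" q "Q q"] by (simp_all add: g_simps)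

text \<open>In a null frame P and Q are dual to each other: the coefficient of P is the product with
  Q, and conversely.\<close>

lemma frame_expand:
  assumes q: "q \<in> U" and x: "x \<in> tangent_space A q"
  shows "x = g q x (\<zeta> q) *\<^sub>R \<zeta> q + (g q x (Q q) *\<^sub>R P q + g q x (P q) *\<^sub>R Q q)"
proof -
  have nz: "P q \<noteq> 0" "Q q \<noteq> 0"
    using g_PQ[OF q] g_QP[OF q] g_zero_left[OF frame_tangent[OF q vQ]]
      g_zero_left[OF frame_tangent[OF q vP]] by (metis zero_neq_one)+
  obtain s t where e: "x = \<eta> q x *\<^sub>R \<zeta> q + (s *\<^sub>R P q + t *\<^sub>R Q q)"
    using eigenvector_decomposition[OF frame_tangent[OF q vP] phi_P[OF q] nz(1)
        frame_tangent[OF q vQ] phi_Q[OF q] nz(2) x] by blast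
  have "g q (\<eta> q x *\<^sub>R \<zeta> q + (s *\<^sub>R P q + t *\<^sub>R Q q)) (Q q) = s"
    "g q (\<eta> q x *\<^sub>R \<zeta> q + (s *\<^sub>R P q + t *\<^sub>R Q q)) (P q) = t"
    using q by (simp_all add: g_simps)
  then have "g q x (Q q) = s" "g q x (P q) = t" using e by simp_all
  then show ?thesis using e g_zeta[OF x] by simp
qed

lemma frame_eqI:
  assumes "q \<in> U" "x \<in> tangent_space A q" "y \<in> tangent_space A q"
    "g q x (\<zeta> q) = g q y (\<zeta> q)" "g q x (P q) = g q y (P q)" "g q x (Q q) = g q y (Q q)"
  shows "x = y"
  using frame_expand[OF assms(1,2)] frame_expand[OF assms(1,3)] assms(4-6) by simp

abbreviation "B \<equiv> bracket A \<zeta> P"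
abbreviation "C \<equiv> bracket A \<zeta> Q"
abbreviation "E \<equiv> bracket A P Q"

lemma eta_brackets:
  assumes q: "q \<in> U"
  shows "\<eta> q (B q) = 0" "\<eta> q (C q) = 0" "\<eta> q (E q) = 2"
proof -
  show "\<eta> q (B q) = 0" using eta_bracket[OF vZ vP q eta_zeta eta_P] q by simp
  show "\<eta> q (C q) = 0" using eta_bracket[OF vZ vQ q eta_zeta eta_Q] q by (simp add: g_simps)
  show "\<eta> q (E q) = 2" using eta_bracket[OF vP vQ q eta_P eta_Q] q by (simp add: g_simps)
qed

lemma bracket_zero_left:
  assumes "smooth_vfield A U X" "smooth_vfield A U Y" "\<And>q. q \<in> U \<Longrightarrow> X q = 0" "q \<in> U"
  shows "bracket A X Y q = 0"
proof -
  have "bracket A X Y q = bracket A (fmult (\<lambda>_. 0) X) Y q"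
  proof (rule bracket_cong[OF assms(1,2) _ _ assms(4)])
    show "X r = fmult (\<lambda>_. 0) X r" if "r \<in> U" for r
      unfolding fmult_def scaleR_zero_left by (rule assms(3)[OF that])
  qed simp
  then show ?thesis
    using bracket_fmult_left[OF assms(1,2) smooth_fun_const[OF U_open] assms(4), of 0] assms(3,4) by simp
qed

text \<open>Normality evaluated on \<open>\<zeta>\<close> and an eigenfield of \<open>\<phi>\<close>.\<close>

lemma phi_bracket_zeta:
  assumes q: "q \<in> U"
  shows "\<phi> q (B q) = B q" "\<phi> q (C q) = - C q"
proof -
  have vphi: "smooth_vfield A U (ap_endo \<phi> X)" if "smooth_vfield A U X" for X
    using phi_vfield that .
  have z: "bracket A (ap_endo \<phi> \<zeta>) X q = 0" if "smooth_vfield A U X" for X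
    by (rule bracket_zero_left[OF vphi[OF vZ] that _ q]) (simp add: ap_endo_apply phi_zeta)
  have PP: "bracket A \<zeta> (ap_endo \<phi> P) q = B q"
    by (rule bracket_cong[OF vZ vphi[OF vP] _ _ q]) (simp_all add: ap_endo_apply)
  have "bracket A (fmult (\<lambda>_. -1) Q) \<zeta> q = (-1) *\<^sub>R bracket A Q \<zeta> q - app \<zeta> (\<lambda>_. -1) q *\<^sub>R Q q"
    by (rule bracket_fmult_left[OF vQ vZ smooth_fun_const[OF U_open] q])
  then have m: "bracket A (fmult (\<lambda>_. -1) Q) \<zeta> q = C q"
    using tvec_const[OF zeta_tangent] bracket_skew[of \<zeta> Q q] by (simp add: app_def)
  have "bracket A \<zeta> (ap_endo \<phi> Q) q = bracket A \<zeta> (fmult (\<lambda>_. -1) Q) q"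
    by (rule bracket_cong[OF vZ vphi[OF vQ] _ _ q]) (simp_all add: ap_endo_apply fmult_def)
  then have QQ: "bracket A \<zeta> (ap_endo \<phi> Q) q = - C q"
    using m bracket_skew[of \<zeta> "fmult (\<lambda>_. -1) Q" q] by (metis minus_minus)
  \<comment> \<open>Since \<open>\<phi>\<close> kills \<open>\<zeta>\<close>, two of the four
    torsion terms vanish. Normality sets the rest to a multiple of g(\<zeta>, \<phi>P) = 0, and the
    square of \<open>\<phi>\<close> fixes \<open>B q\<close> because \<open>\<eta>\<close> vanishes
    on it.\<close>
  have "nijenhuis A \<phi> \<zeta> P q = \<phi> q (\<phi> q (B q)) - \<phi> q (B q)"
    using z[OF vphi[OF vP]] z[OF vP] PP by (simp add: nijenhuis_def ap_endo_apply phi_zero)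
  then show "\<phi> q (B q) = B q"
    using normality[OF vZ vP q] phi_square[of "B q" q] eta_brackets[OF q] q by simp
  have "nijenhuis A \<phi> \<zeta> Q q = \<phi> q (\<phi> q (C q)) + \<phi> q (C q)"
    using z[OF vphi[OF vQ]] z[OF vQ] QQ q by (simp add: nijenhuis_def ap_endo_apply phi_zero phi_neg)
  then show "\<phi> q (C q) = - C q"
    using normality[OF vZ vQ q] phi_square[of "C q" q] eta_brackets[OF q] q
    by (simp add: g_simps add_eq_0_iff)
qed

text \<open>Together with \<open>eta_brackets\<close> this says that \<open>\<zeta>\<close> is a
  Killing field. The first two products vanish because the eigenlines of \<open>\<phi>\<close> are
  null; the third relation is \<open>\<eta>\<close> applied to the Jacobi identity of
  \<open>\<zeta>\<close>, P and Q.\<close>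

lemma g_brackets:
  assumes q: "q \<in> U"
  shows "g q (B q) (P q) = 0" "g q (C q) (Q q) = 0" "g q (B q) (Q q) + g q (C q) (P q) = 0"
proof -
  show "g q (B q) (P q) = 0"
    using g_phi_skew[of "B q" q "P q"] phi_bracket_zeta[OF q] q by simp
  show "g q (C q) (Q q) = 0"
    using g_phi_skew[of "C q" q "Q q"] phi_bracket_zeta[OF q] q by (simp add: g_simps)
  have QZ: "bracket A Q \<zeta> r = - C r" for r by (rule bracket_skew)
  have jac: "bracket A \<zeta> E q + bracket A P (bracket A Q \<zeta>) q + bracket A Q B q = 0"
    by (rule bracket_jacobi[OF vZ vP vQ]) (simp_all add: q)
  have T: "bracket A \<zeta> E q \<in> tangent_space A q" "bracket A P (bracket A Q \<zeta>) q \<in> tangent_space A q"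
    "bracket A Q B q \<in> tangent_space A q" using q by simp_all
  have "\<eta> q (bracket A \<zeta> E q) = - 2 * g q (\<zeta> q) (\<phi> q (E q))"
    by (rule eta_bracket[OF vZ _ q eta_zeta eta_brackets(3)]) simp_all
  also have "\<dots> = 0"
    using g_sym[of "\<zeta> q" q "\<phi> q (E q)"] g_zeta[of "\<phi> q (E q)" q] eta_phi[of "E q" q] phi_tangent[of "E q" q] q
    by simp
  finally have e1: "\<eta> q (bracket A \<zeta> E q) = 0" .
  have e2: "\<eta> q (bracket A P (bracket A Q \<zeta>) q) = - 2 * g q (P q) (\<phi> q (bracket A Q \<zeta> q))"
  proof (rule eta_bracket[OF vP _ q eta_P])
    show "\<eta> r (bracket A Q \<zeta> r) = 0" if "r \<in> U" for r
      using eta_scale[of "C r" r "-1"] eta_brackets[OF that] that by (simp add: QZ)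
  qed simp_all
  have e3: "\<eta> q (bracket A Q B q) = - 2 * g q (Q q) (\<phi> q (B q))"
    by (rule eta_bracket[OF vQ _ q eta_Q eta_brackets(1)]) simp_all
  have "\<eta> q (bracket A \<zeta> E q) + \<eta> q (bracket A P (bracket A Q \<zeta>) q) + \<eta> q (bracket A Q B q) = \<eta> q 0"
    unfolding jac[symmetric] using T eta_linear[of _ q _ 1 1] by simp
  moreover have "\<eta> q 0 = 0" using eta_scale[OF tangent_zero, of q 0] by simp
  ultimately have "- 2 * g q (P q) (\<phi> q (- C q)) + - 2 * g q (Q q) (B q) = 0"
    using e1 e2 e3 phi_bracket_zeta[OF q] by (simp add: QZ)
  then show "g q (B q) (Q q) + g q (C q) (P q) = 0"
    using phi_bracket_zeta[OF q] phi_neg[of "C q" q] g_sym[of "P q" q "C q"] g_sym[of "Q q" q "B q"] q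
    by simp
qed

lemma torsion_rules:
  assumes q: "q \<in> U"
  shows "D \<zeta> P q = D P \<zeta> q + B q" "D \<zeta> Q q = D Q \<zeta> q + C q" "D P Q q = D Q P q + E q"
  using D_torsion[OF vZ vP q] D_torsion[OF vZ vQ q] D_torsion[OF vP vQ q] by (simp_all add: diff_eq_eq add.commute)

text \<open>This is the frame version of \<open>\<nabla>\<^sub>X \<zeta> = - \<phi> X\<close>.\<close>

lemma D_zeta_frame:
  assumes q: "q \<in> U"
  shows "D P \<zeta> q = - P q" "D Q \<zeta> q = Q q" "D \<zeta> \<zeta> q = 0"
proof -
  note S = g_sym[of _ q]
  note t = torsion_rules[OF q] and b = g_brackets[OF q]
  have Bz: "g q (B q) (\<zeta> q) = 0" "g q (C q) (\<zeta> q) = 0" "g q (E q) (\<zeta> q) = 2"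
    using g_zeta eta_brackets[OF q] q by simp_all
  have m: "g q (D X Y q) (Z q) + g q (D X Z q) (Y q) = 0"
    if "smooth_vfield A U X" "smooth_vfield A U Y" "smooth_vfield A U Z" "\<And>r. r \<in> U \<Longrightarrow> g r (Y r) (Z r) = c"
    for X Y Z c
    using D_metric_const[OF that(1,2,3) q that(4)] S[of "Y q" "D X Z q"] that q by simp
  have mz: "g q (D X \<zeta> q) (\<zeta> q) = 0" if "smooth_vfield A U X" for X
    using m[OF that vZ vZ g_ZZ] by simp
  have PP: "g q (D P \<zeta> q) (P q) = 0"
    using m[OF vZ vP vP g_PP] b(1) q by (simp add: t g_simps)
  have QQ: "g q (D Q \<zeta> q) (Q q) = 0"
    using m[OF vZ vQ vQ g_QQ] b(2) q by (simp add: t g_simps)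
  \<comment> \<open>g(P, Q) is constant along \<open>\<zeta>\<close>; torsion trades
    \<open>D \<zeta>\<close> for derivatives of \<open>\<zeta>\<close>, and the bracket terms cancel
    by \<open>g_brackets\<close>.\<close>
  have s1: "g q (D P \<zeta> q) (Q q) + g q (D Q \<zeta> q) (P q) = 0"
    using m[OF vZ vP vQ g_PQ] b(3) q by (simp add: t g_simps)
  \<comment> \<open>The contact condition enters through the \<open>\<zeta>\<close>-component 2 of
    \<open>E\<close>. With \<open>s1\<close> it forces the values 1 and -1 of the two
    products.\<close>
  have s2: "g q (D Q \<zeta> q) (P q) - g q (D P \<zeta> q) (Q q) = 2"
    using m[OF vP vQ vZ g_QZ] m[OF vQ vP vZ g_PZ] Bz(3) q by (simp add: t g_simps)
  show "D P \<zeta> q = - P q"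
    by (rule frame_eqI[OF q]) (use q mz[OF vP] PP s1 s2 in \<open>simp_all add: g_simps\<close>)
  show "D Q \<zeta> q = Q q"
    by (rule frame_eqI[OF q]) (use q mz[OF vQ] QQ s1 s2 in \<open>simp_all add: g_simps\<close>)
  have "g q (D \<zeta> \<zeta> q) (P q) = 0"
    using m[OF vZ vZ vP g_ZP] mz[OF vP] Bz(1) q by (simp add: t g_simps)
  moreover have "g q (D \<zeta> \<zeta> q) (Q q) = 0"
    using m[OF vZ vZ vQ g_ZQ] mz[OF vQ] Bz(2) q by (simp add: t g_simps)
  ultimately show "D \<zeta> \<zeta> q = 0"
    by (intro frame_eqI[OF q]) (use q mz[OF vZ] in \<open>simp_all add: g_simps\<close>)
qed

section \<open>Covariant derivatives and curvature in a null frame\<close>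

definition frame_field :: "('a \<Rightarrow> real) \<Rightarrow> ('a \<Rightarrow> real) \<Rightarrow> ('a \<Rightarrow> real) \<Rightarrow> 'a vfield" where
  "frame_field a b c = fmult a \<zeta> + (fmult b P + fmult c Q)"

lemma frame_field_vfield [simp]:
  "smooth_fun A U a \<Longrightarrow> smooth_fun A U b \<Longrightarrow> smooth_fun A U c \<Longrightarrow> smooth_vfield A U (frame_field a b c)"
  unfolding frame_field_def by (intro vfield_add vfield_fmult) simp_all

lemma frame_field_apply: "frame_field a b c q = a q *\<^sub>R \<zeta> q + (b q *\<^sub>R P q + c q *\<^sub>R Q q)"
  by (simp add: frame_field_def fmult_def)

text \<open>The right-hand side is - \<phi>X. General X is needed for the brackets \<open>B\<close>,
  \<open>C\<close> and \<open>E\<close>, along which the curvature differentiates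
  \<open>\<zeta>\<close>.\<close>

lemma D_zeta:
  assumes X: "smooth_vfield A U X" and q: "q \<in> U"
  shows "D X \<zeta> q = g q (X q) (P q) *\<^sub>R Q q - g q (X q) (Q q) *\<^sub>R P q"
proof -
  note s = g_smooth[OF X vZ] g_smooth[OF X vQ] g_smooth[OF X vP]
  note v = vfield_fmult[OF s(1) vZ] vfield_fmult[OF s(2) vP] vfield_fmult[OF s(3) vQ]
  have "D X \<zeta> q = D (frame_field (ap2 g X \<zeta>) (ap2 g X Q) (ap2 g X P)) \<zeta> q"
  proof (rule D_cong_left[OF X frame_field_vfield[OF s] vZ _ q])
    show "X r = frame_field (ap2 g X \<zeta>) (ap2 g X Q) (ap2 g X P) r" if "r \<in> U" for r
      using frame_expand[OF that, of "X r"] X that by (simp add: frame_field_apply ap2_def)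
  qed
  also have "\<dots> = g q (X q) (P q) *\<^sub>R Q q - g q (X q) (Q q) *\<^sub>R P q"
    unfolding frame_field_def D_add_left[OF v(1) vfield_add[OF v(2,3)] vZ q] D_add_left[OF v(2,3) vZ q]
      D_fmult_left[OF s(1) vZ vZ q] D_fmult_left[OF s(2) vP vZ q] D_fmult_left[OF s(3) vQ vZ q]
      D_zeta_frame[OF q] by (simp add: ap2_def)
  finally show ?thesis .
qed

text \<open>The inner derivatives of \<open>\<zeta>\<close> are first replaced by -P, Q and 0, so
  only first derivatives of frame fields remain; torsion and metric conditions balance them against
  the derivative of \<open>\<zeta>\<close> along the bracket.\<close>

lemma curvature_zeta:
  assumes q: "q \<in> U"
  shows "curvature A D P Q \<zeta> q = 0" "curvature A D \<zeta> P \<zeta> q = P q" "curvature A D \<zeta> Q \<zeta> q = Q q"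
proof -
  note t = torsion_rules[OF q] and b = g_brackets[OF q] and dz = D_zeta_frame[OF q]
  have Bz: "g q (B q) (\<zeta> q) = 0" "g q (C q) (\<zeta> q) = 0" "g q (E q) (\<zeta> q) = 2"
    using g_zeta eta_brackets[OF q] q by simp_all
  have neg: "D X (D P \<zeta>) q = - D X P q" if X: "smooth_vfield A U X" for X
  proof -
    have "D X (D P \<zeta>) q = app X (\<lambda>_. -1) q *\<^sub>R P q + (-1) *\<^sub>R D X P q"
      by (rule D_scale_right[OF X vP smooth_fun_const[OF U_open] D_vfield[OF vP vZ] _ q])
         (simp add: D_zeta_frame)
    then show ?thesis using tvec_const[OF vfield_tangent[OF X q]] by (simp add: app_def)
  qed
  have pos: "D X (D Q \<zeta>) q = D X Q q" if X: "smooth_vfield A U X" for X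
    by (rule D_cong_right[OF X D_vfield[OF vQ vZ] vQ D_zeta_frame(2) q])
  have zero: "D X (D \<zeta> \<zeta>) q = 0" if X: "smooth_vfield A U X" for X
    by (rule D_zero_right[OF X D_vfield[OF vZ vZ] D_zeta_frame(3) q])
  have m: "g q (D X Y q) (Z q) + g q (D X Z q) (Y q) = 0"
    if "smooth_vfield A U X" "smooth_vfield A U Y" "smooth_vfield A U Z" "\<And>r. r \<in> U \<Longrightarrow> g r (Y r) (Z r) = c"
    for X Y Z c
    using D_metric_const[OF that(1,2,3) q that(4)] g_sym[of "Y q" q "D X Z q"] that q by simp
  have PQ: "g q (D P Q q) (P q) = g q (D Q P q) (P q) + g q (E q) (P q)"
    "g q (D P Q q) (Q q) = g q (D Q P q) (Q q) + g q (E q) (Q q)"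
    using q by (simp_all add: t g_simps)
  have "curvature A D P Q \<zeta> q = D P Q q + D Q P q - (g q (E q) (P q) *\<^sub>R Q q - g q (E q) (Q q) *\<^sub>R P q)"
    using D_zeta[of E q] q by (simp add: curvature_apply neg pos)
  also have "\<dots> = 0"
  proof (rule frame_eqI[OF q])
    show "g q (D P Q q + D Q P q - (g q (E q) (P q) *\<^sub>R Q q - g q (E q) (Q q) *\<^sub>R P q)) (\<zeta> q) = g q 0 (\<zeta> q)"
      using m[OF vP vQ vZ g_QZ] m[OF vQ vP vZ g_PZ] dz q by (simp add: g_simps)
    show "g q (D P Q q + D Q P q - (g q (E q) (P q) *\<^sub>R Q q - g q (E q) (Q q) *\<^sub>R P q)) (P q) = g q 0 (P q)"
      using m[OF vQ vP vP g_PP] PQ(1) q by (simp add: g_simps)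
    show "g q (D P Q q + D Q P q - (g q (E q) (P q) *\<^sub>R Q q - g q (E q) (Q q) *\<^sub>R P q)) (Q q) = g q 0 (Q q)"
      using m[OF vP vQ vQ g_QQ] PQ(2) q by (simp add: g_simps)
  qed (use q in simp_all)
  finally show "curvature A D P Q \<zeta> q = 0" .
  have "curvature A D \<zeta> P \<zeta> q = - (- P q + B q) - 0 - (g q (B q) (P q) *\<^sub>R Q q - g q (B q) (Q q) *\<^sub>R P q)"
    using D_zeta[of B q] q zero[OF vP] by (simp add: curvature_apply neg t dz)
  then show "curvature A D \<zeta> P \<zeta> q = P q"
    using b Bz frame_expand[OF q, of "B q"] q by simp
  have "curvature A D \<zeta> Q \<zeta> q = (Q q + C q) - 0 - (g q (C q) (P q) *\<^sub>R Q q - g q (C q) (Q q) *\<^sub>R P q)"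
    using D_zeta[of C q] q zero[OF vQ] by (simp add: curvature_apply pos t dz)
  then show "curvature A D \<zeta> Q \<zeta> q = Q q"
    using b Bz frame_expand[OF q, of "C q"] q by simp
qed

text \<open>This is the sectional curvature of the plane ker \<open>\<eta>\<close>: the Gram
  determinant of P and Q is -1, which explains the order of the arguments.\<close>

definition kappa :: "'a \<Rightarrow> real" where
  "kappa q = g q (curvature A D P Q P q) (Q q)"

lemma curvature_vector [simp]:
  "q \<in> U \<Longrightarrow> smooth_vfield A U X \<Longrightarrow> smooth_vfield A U Y \<Longrightarrow> smooth_vfield A U Z \<Longrightarrow>
    curvature A D X Y Z q \<in> tangent_space A q"
  by (rule curvature_tangent)

text \<open>Metric skewness reduces all components to \<open>curvature_zeta\<close> and
  \<open>kappa\<close>, except g(R(\<zeta>,P)Q, P) and g(R(\<zeta>,Q)P, Q). As R(P,Q)\<zeta> = 0,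
  Bianchi gives R(\<zeta>,P)Q = R(\<zeta>,Q)P, and exchanging the two puts a repeated vector into
  the skew slots.\<close>

lemma curvature_frame:
  assumes q: "q \<in> U"
  shows "curvature A D P Q P q = kappa q *\<^sub>R P q" "curvature A D P Q Q q = - (kappa q *\<^sub>R Q q)"
    "curvature A D \<zeta> P P q = 0" "curvature A D \<zeta> P Q q = - \<zeta> q"
    "curvature A D \<zeta> Q P q = - \<zeta> q" "curvature A D \<zeta> Q Q q = 0"
proof -
  note cz = curvature_zeta[OF q]
  have sk: "g q (curvature A D X Y Z q) (W q) + g q (curvature A D X Y W q) (Z q) = 0"
    if "smooth_vfield A U X" "smooth_vfield A U Y" "smooth_vfield A U Z" "smooth_vfield A U W" for X Y Z W
    using curvature_metric_skew[OF that q] g_sym[of "Z q" q "curvature A D X Y W q"] that q by simp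
  show "curvature A D P Q P q = kappa q *\<^sub>R P q"
    by (rule frame_eqI[OF q])
       (use sk[of P Q P P] sk[of P Q P \<zeta>] cz q in \<open>simp_all add: g_simps kappa_def\<close>)
  show "curvature A D P Q Q q = - (kappa q *\<^sub>R Q q)"
    by (rule frame_eqI[OF q])
       (use sk[of P Q Q Q] sk[of P Q Q \<zeta>] sk[of P Q P Q] cz q in \<open>simp_all add: g_simps kappa_def\<close>)
  have "curvature A D \<zeta> P Q q + curvature A D P Q \<zeta> q + curvature A D Q \<zeta> P q = 0"
    by (rule curvature_bianchi[OF vZ vP vQ q])
  then have bi: "curvature A D \<zeta> P Q q = curvature A D \<zeta> Q P q"
    using curvature_skew[OF vZ vQ vP q] cz by simp
  have m: "g q (curvature A D \<zeta> P Q q) (P q) = 0" "g q (curvature A D \<zeta> Q P q) (Q q) = 0"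
    using sk[of \<zeta> Q P P] sk[of \<zeta> P Q Q] bi by simp_all
  show "curvature A D \<zeta> P P q = 0"
    by (rule frame_eqI[OF q])
       (use sk[of \<zeta> P P P] sk[of \<zeta> P P \<zeta>] sk[of \<zeta> P P Q] cz m q in \<open>simp_all add: g_simps\<close>)
  show "curvature A D \<zeta> P Q q = - \<zeta> q"
    by (rule frame_eqI[OF q])
       (use sk[of \<zeta> P Q Q] sk[of \<zeta> P Q \<zeta>] cz m q in \<open>simp_all add: g_simps\<close>)
  then show "curvature A D \<zeta> Q P q = - \<zeta> q" using bi by simp
  show "curvature A D \<zeta> Q Q q = 0"
    by (rule frame_eqI[OF q])
       (use sk[of \<zeta> Q Q Q] sk[of \<zeta> Q Q \<zeta>] sk[of \<zeta> Q P Q] cz m q in \<open>simp_all add: g_simps\<close>)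
qed

lemma curvature_expand_left:
  assumes X: "smooth_vfield A U X" and Y: "smooth_vfield A U Y" and Z: "smooth_vfield A U Z" and q: "q \<in> U"
  shows "curvature A D X Y Z q = g q (X q) (\<zeta> q) *\<^sub>R curvature A D \<zeta> Y Z q
    + g q (X q) (Q q) *\<^sub>R curvature A D P Y Z q + g q (X q) (P q) *\<^sub>R curvature A D Q Y Z q"
proof -
  note s = g_smooth[OF X vZ] g_smooth[OF X vQ] g_smooth[OF X vP]
  note v = vfield_fmult[OF s(1) vZ] vfield_fmult[OF s(2) vP] vfield_fmult[OF s(3) vQ]
  have "curvature A D X Y Z q = curvature A D (frame_field (ap2 g X \<zeta>) (ap2 g X Q) (ap2 g X P)) Y Z q"
  proof (rule curvature_cong_left[OF X frame_field_vfield[OF s] Y Z _ q])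
    show "X r = frame_field (ap2 g X \<zeta>) (ap2 g X Q) (ap2 g X P) r" if "r \<in> U" for r
      using frame_expand[OF that, of "X r"] X that by (simp add: frame_field_apply ap2_def)
  qed
  then show ?thesis
    unfolding frame_field_def curvature_add_left[OF v(1) vfield_add[OF v(2,3)] Y Z q]
      curvature_add_left[OF v(2,3) Y Z q] curvature_fmult_left[OF s(1) vZ Y Z q]
      curvature_fmult_left[OF s(2) vP Y Z q] curvature_fmult_left[OF s(3) vQ Y Z q]
    by (simp add: ap2_def add.assoc)
qed

lemma curvature_expand_right:
  assumes X: "smooth_vfield A U X" and Y: "smooth_vfield A U Y" and Z: "smooth_vfield A U Z" and q: "q \<in> U"
  shows "curvature A D X Y Z q = g q (Z q) (\<zeta> q) *\<^sub>R curvature A D X Y \<zeta> q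
    + g q (Z q) (Q q) *\<^sub>R curvature A D X Y P q + g q (Z q) (P q) *\<^sub>R curvature A D X Y Q q"
proof -
  note s = g_smooth[OF Z vZ] g_smooth[OF Z vQ] g_smooth[OF Z vP]
  note v = vfield_fmult[OF s(1) vZ] vfield_fmult[OF s(2) vP] vfield_fmult[OF s(3) vQ]
  have "curvature A D X Y Z q = curvature A D X Y (frame_field (ap2 g Z \<zeta>) (ap2 g Z Q) (ap2 g Z P)) q"
  proof (rule curvature_cong_right[OF X Y Z frame_field_vfield[OF s] _ q])
    show "Z r = frame_field (ap2 g Z \<zeta>) (ap2 g Z Q) (ap2 g Z P) r" if "r \<in> U" for r
      using frame_expand[OF that, of "Z r"] Z that by (simp add: frame_field_apply ap2_def)
  qed
  then show ?thesis
    unfolding frame_field_def curvature_add_right[OF X Y v(1) vfield_add[OF v(2,3)] q]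
      curvature_add_right[OF X Y v(2,3) q] curvature_fmult_right[OF s(1) X Y vZ q]
      curvature_fmult_right[OF s(2) X Y vP q] curvature_fmult_right[OF s(3) X Y vQ q]
    by (simp add: ap2_def add.assoc)
qed

text \<open>The first two terms form the tensor of constant curvature -1. The correction vanishes as
  soon as one argument is \<open>\<zeta> q\<close>, and it adjusts R(P,Q) so as to give
  \<open>kappa\<close>.\<close>

definition curv_tensor :: "'a \<Rightarrow> 'a tvec \<Rightarrow> 'a tvec \<Rightarrow> 'a tvec \<Rightarrow> 'a tvec" where
  "curv_tensor q x y z = g q x z *\<^sub>R y - g q y z *\<^sub>R x
    + ((kappa q + 1) * (g q x (Q q) * g q y (P q) - g q x (P q) * g q y (Q q)))
      *\<^sub>R (g q z (Q q) *\<^sub>R P q - g q z (P q) *\<^sub>R Q q)"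

lemma curvature_self:
  assumes X: "smooth_vfield A U X" and Z: "smooth_vfield A U Z" and q: "q \<in> U"
  shows "curvature A D X X Z q = 0"
proof -
  have "(2::real) *\<^sub>R curvature A D X X Z q = 0"
    using curvature_skew[OF X X Z q] by (metis add.left_inverse scaleR_2)
  then show ?thesis by simp
qed

text \<open>Both sides are linear over functions in each slot, so comparing them on frame fields
  suffices. Only the first and third slots are expanded directly; the second is reached by
  exchanging it with the first.\<close>

lemma curvature_formula:
  assumes X: "smooth_vfield A U X" and Y: "smooth_vfield A U Y" and Z: "smooth_vfield A U Z" and q: "q \<in> U"
  shows "curvature A D X Y Z q = curv_tensor q (X q) (Y q) (Z q)"
proof -
  have right: "curvature A D F G Z q = curv_tensor q (F q) (G q) (Z q)"
    if "(F, G) \<in> {(P, Q), (\<zeta>, P), (\<zeta>, Q)}" for F G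
  proof -
    have FG: "smooth_vfield A U F" "smooth_vfield A U G" using that by auto
    show ?thesis
      unfolding curvature_expand_right[OF FG Z q] curv_tensor_def
      using that q g_sym[of "Z q" q "P q"] g_sym[of "Z q" q "Q q"] g_sym[of "Z q" q "\<zeta> q"] Z
      by (auto simp: curvature_frame curvature_zeta algebra_simps)
  qed
  have anti: "curv_tensor q y x z = - curv_tensor q x y z" for x y z
    by (simp add: curv_tensor_def algebra_simps)
  have right': "curvature A D F G Z q = curv_tensor q (F q) (G q) (Z q)"
    if "F \<in> {\<zeta>, P, Q}" "G \<in> {\<zeta>, P, Q}" for F G
  proof -
    have FG: "smooth_vfield A U F" "smooth_vfield A U G" using that by auto
    have "F = G \<or> (F, G) \<in> {(P, Q), (\<zeta>, P), (\<zeta>, Q)} \<or> (G, F) \<in> {(P, Q), (\<zeta>, P), (\<zeta>, Q)}"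
      using that by blast
    then show ?thesis
    proof (elim disjE)
      assume "F = G"
      then show ?thesis using curvature_self[OF FG(2) Z q] by (simp add: curv_tensor_def)
    next
      assume "(G, F) \<in> {(P, Q), (\<zeta>, P), (\<zeta>, Q)}"
      then show ?thesis using right curvature_skew[OF FG(2,1) Z q] anti by metis
    qed (use right in blast)
  qed
  have lin: "curv_tensor q x y z = g q x (\<zeta> q) *\<^sub>R curv_tensor q (\<zeta> q) y z
    + g q x (Q q) *\<^sub>R curv_tensor q (P q) y z + g q x (P q) *\<^sub>R curv_tensor q (Q q) y z"
    if "x \<in> tangent_space A q" "y \<in> tangent_space A q" "z \<in> tangent_space A q" for x y z
  proof -
    have "curv_tensor q (a *\<^sub>R \<zeta> q + (b *\<^sub>R P q + c *\<^sub>R Q q)) y z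
       = a *\<^sub>R curv_tensor q (\<zeta> q) y z + b *\<^sub>R curv_tensor q (P q) y z + c *\<^sub>R curv_tensor q (Q q) y z" for a b c
      using that q by (simp add: curv_tensor_def g_simps algebra_simps)
    from this[of "g q x (\<zeta> q)" "g q x (Q q)" "g q x (P q)"] show ?thesis
      unfolding frame_expand[OF q that(1), symmetric] .
  qed
  have left: "curvature A D X F Z q = curv_tensor q (X q) (F q) (Z q)" if F: "F \<in> {\<zeta>, P, Q}" for F
  proof -
    have vF: "smooth_vfield A U F" using F by auto
    show ?thesis
      unfolding curvature_expand_left[OF X vF Z q] lin[OF vfield_tangent[OF X q] vfield_tangent[OF vF q] vfield_tangent[OF Z q]]
      using F right'[of _ F] by simp
  qed
  have left': "curvature A D F X Z q = curv_tensor q (F q) (X q) (Z q)" if F: "F \<in> {\<zeta>, P, Q}" for F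
  proof -
    have vF: "smooth_vfield A U F" using F by auto
    show ?thesis using left[OF F] curvature_skew[OF X vF Z q] anti by metis
  qed
  have "curvature A D Y X Z q = curv_tensor q (Y q) (X q) (Z q)"
    unfolding curvature_expand_left[OF Y X Z q] lin[OF vfield_tangent[OF Y q] vfield_tangent[OF X q] vfield_tangent[OF Z q]]
    using left' by simp
  then show ?thesis using curvature_skew[OF Y X Z q] anti by metis
qed

end

section \<open>Ricci tensor and solitons\<close>

context para_sasakian_3manifold
begin

text \<open>Eigenvectors at p are extended to arbitrary fields, which the sum and the difference of
  \<open>\<phi>\<close> squared and \<open>\<phi>\<close> then push into the eigenlines at every
  nearby point, because the cube of \<open>\<phi>\<close> is \<open>\<phi>\<close>. Dividing Q by
  g(P, Q) normalises the pair.\<close>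

lemma frame_exists:
  obtains U P Q where "p \<in> U" "para_sasakian_frame A g D \<phi> \<zeta> \<eta> U P Q"
proof -
  obtain v where "v \<in> {v \<in> tangent_space A p. \<eta> p v = 0 \<and> \<phi> p v = v}" "v \<noteq> 0"
    by (rule dim_one_nonzero[OF dim_eigenspaces(1)])
  then have v: "v \<in> tangent_space A p" "\<phi> p v = v" "v \<noteq> 0" by simp_all
  obtain w where "w \<in> {v \<in> tangent_space A p. \<eta> p v = 0 \<and> \<phi> p v = - v}" "w \<noteq> 0"
    by (rule dim_one_nonzero[OF dim_eigenspaces(2)])
  then have w: "w \<in> tangent_space A p" "\<phi> p w = - w" "w \<noteq> 0" by simp_all
  obtain U1 X where X: "p \<in> U1" "smooth_vfield A U1 X" "X p = v"
    by (rule tangent_vector_extends[OF v(1)])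
  obtain U2 Y where Y: "p \<in> U2" "smooth_vfield A U2 Y" "Y p = w"
    by (rule tangent_vector_extends[OF w(1)])
  define V where "V = U1 \<inter> U2"
  have V: "open V" "p \<in> V" "V \<subseteq> U1" "V \<subseteq> U2"
    using X Y vfield_open by (auto simp: V_def)
  have vX: "smooth_vfield A V X" and vY: "smooth_vfield A V Y"
    using vfield_subset X(2) Y(2) V by blast+
  define P where "P = ap_endo \<phi> X + ap_endo \<phi> (ap_endo \<phi> X)"
  define Q where "Q = ap_endo \<phi> (ap_endo \<phi> Y) + fmult (\<lambda>_. -1) (ap_endo \<phi> Y)"
  have vP: "smooth_vfield A V P" and vQ: "smooth_vfield A V Q"
    unfolding P_def Q_def
    using vX vY V(1) by (auto intro!: vfield_add vfield_fmult phi_vfield smooth_fun_const)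
  have Pq: "P q = \<phi> q (X q) + \<phi> q (\<phi> q (X q))" and Qq: "Q q = \<phi> q (\<phi> q (Y q)) - \<phi> q (Y q)" for q
    by (simp_all add: P_def Q_def ap_endo_apply fmult_def)
  have T: "X q \<in> tangent_space A q" "Y q \<in> tangent_space A q" if "q \<in> V" for q
    using vfield_tangent vX vY that by blast+
  have phiP: "\<phi> q (P q) = P q" and phiQ: "\<phi> q (Q q) = - Q q" if "q \<in> V" for q
    using T[OF that] phi_tangent
    by (simp_all add: Pq Qq phi_add phi_diff phi_cube add.commute)
  define k where "k = ap2 g P Q"
  have k: "smooth_fun A V k" unfolding k_def by (rule g_smooth[OF vP vQ])
  define U where "U = {q \<in> V. k q \<noteq> 0}"
  have U: "open U" "U \<subseteq> V" using open_nonzero_set[OF k] by (auto simp: U_def)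
  have vv: "g p v v = 0" using g_phi_skew[OF v(1,1)] v(2) by simp
  have vz: "g p v (\<zeta> p) = 0" using g_zeta[OF v(1)] eta_phi[OF v(1)] v(2) by simp
  \<comment> \<open>Since v is null and orthogonal to \<open>\<zeta> p\<close>, only w is left to
    pair with it, and nondegeneracy demands that it does.\<close>
  have vw: "g p v w \<noteq> 0"
  proof
    assume 0: "g p v w = 0"
    have "g p v x = 0" if x: "x \<in> tangent_space A p" for x
    proof -
      obtain s t where "x = \<eta> p x *\<^sub>R \<zeta> p + (s *\<^sub>R v + t *\<^sub>R w)"
        using eigenvector_decomposition[OF v w x] by blast
      moreover have "g p v (\<eta> p x *\<^sub>R \<zeta> p + (s *\<^sub>R v + t *\<^sub>R w)) = 0"
        using v(1) w(1) zeta_tangent by (simp add: g_simps tangent_simps vv vz 0)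
      ultimately show ?thesis by simp
    qed
    then show False using g_nondegenerate[OF v(1)] v(3) by blast
  qed
  \<comment> \<open>The two operators act as multiplication by 2 on the respective eigenvectors,
    whence the factor 4 below.\<close>
  have "P p = 2 *\<^sub>R v" "Q p = 2 *\<^sub>R w"
    unfolding Pq Qq X(3) Y(3) v(2) w(2) phi_neg[OF w(1)] scaleR_2 by simp_all
  then have "k p = 4 * g p v w"
    using v(1) w(1) by (simp add: k_def ap2_def g_simps tangent_simps)
  then have pU: "p \<in> U" using V vw by (simp add: U_def)
  let ?Q = "fmult (\<lambda>q. inverse (k q)) Q"
  have ik: "smooth_fun A U (\<lambda>q. inverse (k q))"
    by (rule smooth_fun_inverse[OF smooth_fun_subset[OF k U(2,1)]]) (simp add: U_def)
  have "para_sasakian_frame A g D \<phi> \<zeta> \<eta> U P ?Q"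
  proof unfold_locales
    show "smooth_vfield A U P" by (rule vfield_subset[OF vP U(2,1)])
    show "smooth_vfield A U ?Q" by (rule vfield_fmult[OF ik vfield_subset[OF vQ U(2,1)]])
    fix q assume q: "q \<in> U"
    then have qV: "q \<in> V" and kq: "k q \<noteq> 0" by (simp_all add: U_def)
    note PT = vfield_tangent[OF vP qV] and QT = vfield_tangent[OF vQ qV]
    show "\<phi> q (P q) = P q" by (rule phiP[OF qV])
    show "\<phi> q (?Q q) = - ?Q q" using phi_scale[OF QT] phiQ[OF qV] by (simp add: fmult_def)
    show "g q (P q) (?Q q) = 1"
      using g_scale_right[OF PT QT] kq by (simp add: fmult_def k_def ap2_def)
  qed
  then show ?thesis using that pU by blast
qed

end

context para_sasakian_frame
begin

lemma frame_restrict: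
  assumes "open W" "W \<subseteq> U" shows "para_sasakian_frame A g D \<phi> \<zeta> \<eta> W P Q"
  by unfold_locales (use assms vfield_subset[OF vP] vfield_subset[OF vQ] in auto)

text \<open>Fields and frame may live on different open sets. Since \<open>curv_tensor\<close> does
  not mention U, it is unchanged when the frame is restricted to the intersection.\<close>

lemma curvature_formula_local:
  assumes X: "smooth_vfield A W X" and Y: "smooth_vfield A W Y" and Z: "smooth_vfield A W Z"
    and q: "q \<in> W" "q \<in> U"
  shows "curvature A D X Y Z q = curv_tensor q (X q) (Y q) (Z q)"
proof -
  have o: "open (W \<inter> U)" by (rule open_Int[OF vfield_open[OF X] U_open])
  have *: "smooth_vfield A (W \<inter> U) F" if "smooth_vfield A W F" for F
    by (rule vfield_subset[OF that _ o]) simp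
  show ?thesis
    by (rule para_sasakian_frame.curvature_formula[OF frame_restrict[OF o] *[OF X] *[OF Y] *[OF Z]])
       (use q in simp_all)
qed

text \<open>The definite description is unambiguous because \<open>curv_tensor\<close> depends only
  on the values of the fields at q.\<close>

lemma curvature_at_formula:
  assumes q: "q \<in> U" and x: "x \<in> tangent_space A q" and y: "y \<in> tangent_space A q"
    and z: "z \<in> tangent_space A q"
  shows "curvature_at A D q x y z = curv_tensor q x y z"
  unfolding curvature_at_def
proof (rule the_equality)
  obtain U1 X where X: "q \<in> U1" "smooth_vfield A U1 X" "X q = x"
    by (rule tangent_vector_extends[OF x])
  obtain U2 Y where Y: "q \<in> U2" "smooth_vfield A U2 Y" "Y q = y"
    by (rule tangent_vector_extends[OF y])
  obtain U3 Z where Z: "q \<in> U3" "smooth_vfield A U3 Z" "Z q = z"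
    by (rule tangent_vector_extends[OF z])
  define W where "W = U1 \<inter> U2 \<inter> U3"
  have W: "open W" "q \<in> W" using X Y Z vfield_open by (auto simp: W_def)
  have v: "smooth_vfield A W X" "smooth_vfield A W Y" "smooth_vfield A W Z"
    using vfield_subset[OF X(2) _ W(1)] vfield_subset[OF Y(2) _ W(1)] vfield_subset[OF Z(2) _ W(1)]
    by (auto simp: W_def)
  then show "\<exists>U X Y Z. q \<in> U \<and> smooth_vfield A U X \<and> smooth_vfield A U Y \<and> smooth_vfield A U Z \<and>
      X q = x \<and> Y q = y \<and> Z q = z \<and> curv_tensor q x y z = curvature A D X Y Z q"
    using W(2) X(3) Y(3) Z(3) curvature_formula_local[OF v W(2) q]
    by (intro exI[of _ W] exI[of _ X] exI[of _ Y] exI[of _ Z]) simp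
next
  fix w
  assume "\<exists>U X Y Z. q \<in> U \<and> smooth_vfield A U X \<and> smooth_vfield A U Y \<and> smooth_vfield A U Z \<and>
      X q = x \<and> Y q = y \<and> Z q = z \<and> w = curvature A D X Y Z q"
  then obtain W X Y Z where "q \<in> W" "smooth_vfield A W X" "smooth_vfield A W Y" "smooth_vfield A W Z"
      "X q = x" "Y q = y" "Z q = z" "w = curvature A D X Y Z q" by (elim exE conjE)
  then show "w = curv_tensor q x y z" using curvature_formula_local[of W X Y Z q] q by simp
qed

text \<open>This is the known S = (r/2 + 1) g - (r/2 + 3) \<eta> \<otimes> \<eta> with r = 2 kappa -
  4; the last factor is the frame expression of g - \<eta> \<otimes> \<eta>.\<close>

lemma ricci_formula:
  assumes q: "q \<in> U" and y: "y \<in> tangent_space A q" and z: "z \<in> tangent_space A q"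
  shows "ricci A D q y z = - 2 * g q y z
    + (kappa q + 1) * (g q y (P q) * g q z (Q q) + g q y (Q q) * g q z (P q))"
proof -
  let ?w = "g q z (Q q) *\<^sub>R P q - g q z (P q) *\<^sub>R Q q"
  \<comment> \<open>The multiple of the identity in \<open>curv_tensor\<close> is split along the
    frame into three rank one maps, which contribute - 3 g(y,z) to the trace; the first entry
    contributes g(y,z).\<close>
  let ?ps = "[(\<lambda>x. g q x z, y), (\<lambda>x. - g q y z * g q x (\<zeta> q), \<zeta> q), (\<lambda>x. - g q y z * g q x (Q q), P q),
    (\<lambda>x. - g q y z * g q x (P q), Q q),
    (\<lambda>x. (kappa q + 1) * (g q x (Q q) * g q y (P q) - g q x (P q) * g q y (Q q)), ?w)]"
  have T: "P q \<in> tangent_space A q" "Q q \<in> tangent_space A q" "\<zeta> q \<in> tangent_space A q"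
    using q by simp_all
  have lin: "linear_map_on (tangent_space A q) (\<lambda>x. c * g q x a + d * g q x b)"
    if "a \<in> tangent_space A q" "b \<in> tangent_space A q" for a b c d
    using that by (simp add: linear_map_on_def g_simps algebra_simps)
  have "ricci A D q y z = (\<Sum>(a, e)\<leftarrow>?ps. a e)"
    unfolding ricci_def
  proof (rule trace_on_rank_one_sum[OF subspace_tangent_space])
    show "finite {\<zeta> q, P q, Q q}" by simp
    show "tangent_space A q \<subseteq> span {\<zeta> q, P q, Q q}"
    proof
      fix x assume "x \<in> tangent_space A q"
      from frame_expand[OF q this] show "x \<in> span {\<zeta> q, P q, Q q}"
        by (metis insertI1 insertI2 span_add span_base span_scale)
    qed
    show "curvature_at A D q x y z = (\<Sum>(a, e)\<leftarrow>?ps. a x *\<^sub>R e)" if x: "x \<in> tangent_space A q" for x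
    proof -
      have "g q y z *\<^sub>R x = g q y z *\<^sub>R (g q x (\<zeta> q) *\<^sub>R \<zeta> q + (g q x (Q q) *\<^sub>R P q + g q x (P q) *\<^sub>R Q q))"
        using frame_expand[OF q x] by simp
      then show ?thesis
        unfolding curvature_at_formula[OF q x y z] curv_tensor_def
        by (simp add: scaleR_add_right)
    qed
    show "e \<in> tangent_space A q \<and> linear_map_on (tangent_space A q) a" if "(a, e) \<in> set ?ps" for a e
    proof
      show "e \<in> tangent_space A q" using that y T by auto
      show "linear_map_on (tangent_space A q) a"
        using that lin[OF z z, of 1 0] lin[OF T(3,3), of "- g q y z" 0] lin[OF T(2,2), of "- g q y z" 0]
          lin[OF T(1,1), of "- g q y z" 0]
          lin[OF T(2,1), of "(kappa q + 1) * g q y (P q)" "- (kappa q + 1) * g q y (Q q)"]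
        by (auto simp: algebra_simps)
    qed
  qed
  also have "\<dots> = - 2 * g q y z
    + (kappa q + 1) * (g q y (P q) * g q z (Q q) + g q y (Q q) * g q z (P q))"
    using q by (simp add: g_simps algebra_simps)
  finally show ?thesis .
qed

text \<open>The derivatives along P and Q trade places because P and Q are dual to each
  other.\<close>

lemma gradient_frame:
  assumes f: "smooth_fun A U f" and q: "q \<in> U"
  shows "gradient A g f q = frame_field (app \<zeta> f) (app Q f) (app P f) q"
  unfolding gradient_def
proof (rule the_equality)
  let ?G = "frame_field (app \<zeta> f) (app Q f) (app P f) q"
  have vG: "smooth_vfield A U (frame_field (app \<zeta> f) (app Q f) (app P f))"
    by (rule frame_field_vfield) (simp_all add: vfield_app f)
  have T: "?G \<in> tangent_space A q" by (rule vfield_tangent[OF vG q])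
  have rep: "g q ?G w = w f" if w: "w \<in> tangent_space A q" for w
  proof -
    have "w f = (g q w (\<zeta> q) *\<^sub>R \<zeta> q + (g q w (Q q) *\<^sub>R P q + g q w (P q) *\<^sub>R Q q)) f"
      using frame_expand[OF q w] by simp
    also have "\<dots> = g q w (\<zeta> q) * app \<zeta> f q + (g q w (Q q) * app P f q + g q w (P q) * app Q f q)"
      by (simp add: scaleR_fun_def app_def)
    also have "\<dots> = g q w ?G"
      using w q by (simp add: frame_field_apply g_simps)
    finally show ?thesis using g_sym[OF w T] by simp
  qed
  show "?G \<in> tangent_space A q \<and> (\<forall>w\<in>tangent_space A q. g q ?G w = w f)" using T rep by blast
  fix v assume v: "v \<in> tangent_space A q \<and> (\<forall>w\<in>tangent_space A q. g q v w = w f)"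
  then have "g q (v - ?G) w = 0" if "w \<in> tangent_space A q" for w
    using rep[OF that] T that by (simp add: g_simps)
  then have "v - ?G = 0" using g_nondegenerate tangent_diff[OF conjunct1[OF v] T] by blast
  then show "v = ?G" by simp
qed

lemma gradient_vfield:
  assumes f: "smooth_fun A U f" shows "smooth_vfield A U (gradient A g f)"
proof (rule vfield_cong)
  show "smooth_vfield A U (frame_field (app \<zeta> f) (app Q f) (app P f))"
    by (rule frame_field_vfield) (simp_all add: vfield_app f)
qed (simp add: gradient_frame[OF f])

lemma soliton_kappa:
  assumes sol: "proper_h_almost_gradient_RY_soliton A g D h f lam \<alpha> \<beta>" and q: "q \<in> U"
  shows "kappa q = -1"
proof -
  have f: "smooth_fun A U f" and h: "smooth_fun A U h" and alpha: "\<alpha> \<noteq> 0"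
    using sol smooth_fun_subset[of UNIV _ U]
    unfolding proper_h_almost_gradient_RY_soliton_def h_almost_gradient_RY_soliton_def by simp_all
  define G where "G = gradient A g f"
  have vG: "smooth_vfield A U G" unfolding G_def by (rule gradient_vfield[OF f])
  \<comment> \<open>The part - 2 g of the Ricci tensor is merged with the soliton coefficient;
    \<open>m\<close> is the total factor of g in h times the Hessian.\<close>
  define m where "m r = 2 * \<alpha> - (lam r - \<beta> / 2 * scalar_curvature A g D r)" for r
  have hess: "h r * g r (D X G r) (Y r) = m r * g r (X r) (Y r)
      - \<alpha> * (kappa r + 1) * (g r (X r) (P r) * g r (Y r) (Q r) + g r (X r) (Q r) * g r (Y r) (P r))"
    if X: "smooth_vfield A U X" and Y: "smooth_vfield A U Y" and r: "r \<in> U" for X Y r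
  proof -
    have "h r * hessian A g D f X Y r + (lam r - \<beta> / 2 * scalar_curvature A g D r) * ap2 g X Y r
        + \<alpha> * ap2 (ricci A D) X Y r = 0"
      using sol X Y r
      unfolding proper_h_almost_gradient_RY_soliton_def h_almost_gradient_RY_soliton_def by blast
    then show ?thesis
      using ricci_formula[OF r vfield_tangent[OF X r] vfield_tangent[OF Y r]]
      by (simp add: hessian_def ap2_def G_def m_def algebra_simps)
  qed
  have "\<alpha> * (kappa q + 1) = 0"
  proof (cases "h q = 0")
    case True
    have "m q = 0" using hess[OF vZ vZ q] True q by simp
    then show ?thesis using hess[OF vP vQ q] True q by simp
  next
    case False
    \<comment> \<open>The second derivatives of G at q need the formulas for its first derivatives
      on a whole neighbourhood.\<close>
    define W where "W = {r \<in> U. h r \<noteq> 0}"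
    have W: "open W" "W \<subseteq> U" "q \<in> W" using open_nonzero_set[OF h] False q by (auto simp: W_def)
    have rW: "smooth_vfield A W X" if "smooth_vfield A U X" for X
      by (rule vfield_subset[OF that W(2,1)])
    \<comment> \<open>The common factor is read off from G rather than from \<open>m\<close> and
      \<open>kappa\<close>, so its smoothness follows from that of \<open>D\<close> and g.\<close>
    define \<sigma> where "\<sigma> = ap2 g (D P G) Q"
    have s: "smooth_fun A W \<sigma>"
      unfolding \<sigma>_def by (rule smooth_fun_subset[OF g_smooth[OF D_vfield[OF vP vG] vQ] W(2,1)])
    have DP: "D P G r = \<sigma> r *\<^sub>R P r" and DQ: "D Q G r = \<sigma> r *\<^sub>R Q r" if "r \<in> W" for r
    proof -
      have r: "r \<in> U" and hr: "h r \<noteq> 0" using that by (simp_all add: W_def)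
      have z: "g r (D P G r) (\<zeta> r) = 0" "g r (D P G r) (P r) = 0" "g r (D Q G r) (\<zeta> r) = 0" "g r (D Q G r) (Q r) = 0"
        using hess[OF vP vZ r] hess[OF vP vP r] hess[OF vQ vZ r] hess[OF vQ vQ r] r hr by simp_all
      \<comment> \<open>The symmetry of the Hessian in P and Q is inherited from the right-hand side
        of \<open>hess\<close>.\<close>
      have "h r * g r (D Q G r) (P r) = h r * g r (D P G r) (Q r)"
        using hess[OF vP vQ r] hess[OF vQ vP r] r by simp
      then have c: "g r (D Q G r) (P r) = g r (D P G r) (Q r)" using hr by simp
      show "D P G r = \<sigma> r *\<^sub>R P r" 
        by (rule frame_eqI[OF r]) (use r vG z in \<open>simp_all add: g_simps \<sigma>_def ap2_def\<close>)
      show "D Q G r = \<sigma> r *\<^sub>R Q r" 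
        by (rule frame_eqI[OF r]) (use r vG z c in \<open>simp_all add: g_simps \<sigma>_def ap2_def\<close>)
    qed
    have dd: "D P (D Q G) q = app P \<sigma> q *\<^sub>R Q q + \<sigma> q *\<^sub>R D P Q q"
      "D Q (D P G) q = app Q \<sigma> q *\<^sub>R P q + \<sigma> q *\<^sub>R D Q P q"
      by (rule D_scale_right[OF rW[OF vP] rW[OF vQ] s rW[OF D_vfield[OF vQ vG]] DQ W(3)],
          assumption, rule D_scale_right[OF rW[OF vQ] rW[OF vP] s rW[OF D_vfield[OF vP vG]] DP W(3)])
    have "g q (curvature A D P Q G q) (\<zeta> q) + g q (G q) (curvature A D P Q \<zeta> q) = 0"
      by (rule curvature_metric_skew[OF vP vQ vG vZ q])
    then have "g q (curvature A D P Q G q) (\<zeta> q) = 0"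
      using curvature_zeta(1)[OF q] g_zero_right[OF vfield_tangent[OF vG q]] by simp
    then have "\<sigma> q * g q (D P Q q) (\<zeta> q) - \<sigma> q * g q (D Q P q) (\<zeta> q) = g q (D E G q) (\<zeta> q)"
      using q vG by (simp add: curvature_apply dd g_simps)
    moreover have Ez: "g q (E q) (\<zeta> q) = 2" using g_zeta eta_brackets[OF q] q by simp
    ultimately have "2 * \<sigma> q = g q (D E G q) (\<zeta> q)"
      using q by (simp add: torsion_rules[OF q] g_simps algebra_simps)
    then have "2 * (h q * \<sigma> q) = h q * g q (D E G q) (\<zeta> q)" by simp
    \<comment> \<open>Against \<open>\<zeta> q\<close> the correction term of \<open>hess\<close>
      vanishes, so only \<open>m\<close> and the \<open>\<zeta>\<close>-component 2 of
      \<open>E\<close> appear.\<close>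
    also have "\<dots> = 2 * m q" using hess[OF bracket_vfield[OF vP vQ] vZ q] Ez q by simp
    finally have "h q * \<sigma> q = m q" by simp
    \<comment> \<open>The pair (P, Q) does see the correction; comparing the two values of
      \<open>h q * \<sigma> q\<close> isolates it.\<close>
    moreover have "h q * \<sigma> q = m q - \<alpha> * (kappa q + 1)"
      using hess[OF vP vQ q] q by (simp add: \<sigma>_def ap2_def)
    ultimately show ?thesis by simp
  qed
  then show ?thesis using alpha by simp
qed

end

theorem theorem5p2:
  fixes A :: "('a::{t2_space, second_countable_topology}, 3) atlas"
    and \<phi> :: "'a endo_field" and \<zeta> :: "'a vfield" and \<eta> :: "'a form1" and g :: "'a form2"
    and D :: "'a connection"
    and h f lam :: "'a \<Rightarrow> real" and \<alpha> \<beta> :: real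
  assumes "smooth_atlas A"
    and "para_sasakian 1 A \<phi> \<zeta> \<eta> g"
    and "levi_civita A g D"
    and "proper_h_almost_gradient_RY_soliton A g D h f lam \<alpha> \<beta>"
  shows "constant_curvature A g D (- 1)"
proof -
  have metric: "semi_riemannian_metric A g"
    using assms(2) unfolding para_sasakian_def paracontact_metric_def almost_paracontact_metric_def
    by blast
  interpret para_sasakian_3manifold A g D \<phi> \<zeta> \<eta>
    by unfold_locales (fact assms metric)+
  show ?thesis
    unfolding constant_curvature_def
  proof (intro allI impI ballI)
    fix U X Y Z p
    assume v: "smooth_vfield A U X" "smooth_vfield A U Y" "smooth_vfield A U Z" and p: "p \<in> U"
    obtain W P Q where W: "p \<in> W" "para_sasakian_frame A g D \<phi> \<zeta> \<eta> W P Q"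
      using frame_exists by blast
    interpret F: para_sasakian_frame A g D \<phi> \<zeta> \<eta> W P Q by (rule W(2))
    \<comment> \<open>For \<open>kappa\<close> equal to -1 the correction in
      \<open>curv_tensor\<close> disappears.\<close>
    show "curvature A D X Y Z p = (- 1) *\<^sub>R (ap2 g Y Z p *\<^sub>R X p - ap2 g X Z p *\<^sub>R Y p)"
      using F.curvature_formula_local[OF v p W(1)] F.soliton_kappa[OF assms(4) W(1)]
      by (simp add: F.curv_tensor_def ap2_def)
  qed
qed

end
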